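(* Assume that there exist functions $\Psi_0,\varepsilon_0\in\Sigma_d$ such that the following resolvent inequality holds: $$\omega^2\lVert u\rVert_H^2+\lVert A_0^{1/2}u\rVert_H^2\le\sup\Big\{\frac{\lVert C_0u\rVert_Y^2}{\Psi_0(\omega)},\ \frac{\lVert(A_0-\omega^2I)u\rVert_H^2}{\varepsilon_0(\omega)}\Big\},\qquad\forall\omega\in\mathbb{R},\ \forall u\in D(A_0)\setminus\{0\}.$$ Then the system $\dot z(t)-iAz(t)=0$ $(t>0)$, $y(t)=Cz(t)$, $z(0)=z_0$ is weakly observable, and (equivalently) there exist functions $\Psi,\varepsilon\in\Sigma_d$ such that the following resolvent inequality holds: $$\lVert z\rVert_X^2\le\sup\Big\{\frac{\lVert Cz\rVert_Y^2}{\Psi(\lambda_{|A|}(z))},\ \frac{\lVert(A-\lambda I)z\rVert_X^2}{(\lambda-\lambda_A(z))^2+\varepsilon(\lambda_{|A|}(z))}\Big\},\qquad\forall\lambda\in\mathbb{R},\ \forall z\in D(A)\setminus\{0\}.$$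
   Context: Setting. $H$ and $Y$ are complex Hilbert spaces. $A_0:D(A_0)\subset H\to H$ is an unbounded self-adjoint positive operator with compact resolvent. For $\beta\ge 0$, $H_\beta=D(A_0^{\beta/2})$ with norm $\|u\|_{H_\beta}=\|A_0^{\beta/2}u\|_H$ (so $H_2=D(A_0)$, $H_1=D(A_0^{1/2})$). $(\lambda_k)_{k\in\mathbb{N}^*}$ is the non-decreasing sequence of (positive) eigenvalues of $A_0^{1/2}$, and $(\phi_k)_{k\in\mathbb{N}^*}$ is a corresponding orthonormal basis of eigenvectors in $H$. $C_0\in\mathcal L(D(A_0),Y)$ is a bounded linear operator. Let $X=H_1\times H$ with the product norm $\|(u,v)\|_X^2=\|A_0^{1/2}u\|_H^2+\|v\|_H^2$, and $$A=-i\begin{pmatrix}0&I\\-A_0&0\end{pmatrix},\quad D(A)=D(A_0)\times H_1,\qquad C=\begin{pmatrix}C_0&0\end{pmatrix}\in\mathcal L(D(A),Y),$$ so $A(u,v)=(-iv,\,iA_0u)$ is self-adjoint on $X$ with compact resolvent, and $C(u,v)=C_0u$. By Stone's theorem $iA$ generates a strongly continuous group of isometries $(e^{itA})_{t\in\mathbb{R}}$ on $X$. Standing assumption: $C$ is admissible, i.e. for every $T>0$ there is $C_T>0$ with $\int_0^T\|Ce^{itA}z_0\|_Y^2dt\le C_T\|z_0\|_X^2$ for all $z_0\in D(A)$ ($C_T$ taken non-decreasing in $T$). Eigenpairs of $A$: for $k\in\mathbb{Z}^*=\mathbb{Z}\setminus\{0\}$, $\mu_k=\operatorname{sign}(k)\lambda_{|k|}$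 and $\psi_k=\frac1{\sqrt2}\big(\frac1{i\mu_k}\phi_{|k|},\phi_{|k|}\big)^t$; $(\psi_k)$ is an orthonormal basis of $X$ with $A\psi_k=\mu_k\psi_k$. Frequency functions: for $z\in D(A)\setminus\{0\}$, $$\lambda_A(z)=\frac{\langle Az,z\rangle_X}{\|z\|_X^2}=\frac{\sum_{k\in\mathbb{Z}^*}\mu_k|\langle z,\psi_k\rangle_X|^2}{\sum_{k\in\mathbb{Z}^*}|\langle z,\psi_k\rangle_X|^2},\qquad \lambda_{|A|}(z)=\frac{\sum_{k\in\mathbb{Z}^*}\lambda_{|k|}|\langle z,\psi_k\rangle_X|^2}{\sum_{k\in\mathbb{Z}^*}|\langle z,\psi_k\rangle_X|^2}.$$ $\Sigma_d$ (resp. $\Sigma_i$) is the set of functions $\mathbb{R}\to(0,\infty)$ that are even, continuous, and non-increasing (resp. non-decreasing) on $[0,\infty)$. Weak observability: the system is weakly observable if there exist $\mathtt T\in\Sigma_i$ and $\Psi\in\Sigma_d$ such that $\Psi(\lambda_{|A|}(z_0))\|z_0\|_X^2\le\int_0^{\mathtt T(\lambda_{|A|}(z_0))}\|Ce^{itA}z_0\|_Y^2dt$ for all $z_0\in D(A)\setminus\{0\}$. *)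

theory Defs
  imports "HOL-Analysis.Analysis"
begin

section \<open>Complex Hilbert spaces\<close>

class complex_vector = real_vector +
  fixes scaleC :: "complex \<Rightarrow> 'a \<Rightarrow> 'a"  (infixr \<open>*\<^sub>C\<close> 75)
  assumes scaleC_add_right: "c *\<^sub>C (x + y) = c *\<^sub>C x + c *\<^sub>C y"
    and scaleC_add_left: "(c + d) *\<^sub>C x = c *\<^sub>C x + d *\<^sub>C x"
    and scaleC_scaleC: "c *\<^sub>C (d *\<^sub>C x) = (c * d) *\<^sub>C x"
    and scaleR_scaleC: "r *\<^sub>R x = complex_of_real r *\<^sub>C x"

lemma vector_space_scaleC: "vector_space (scaleC :: complex \<Rightarrow> 'a \<Rightarrow> 'a::complex_vector)"
proof
  show "1 *\<^sub>C x = x" for x :: 'a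
    using scaleR_scaleC[of 1 x] by simp
qed (simp_all add: scaleC_add_right scaleC_add_left scaleC_scaleC)

text \<open>The inner product is linear in its first argument.\<close>

class complex_hilbert = complex_vector + banach +
  fixes cinner :: "'a \<Rightarrow> 'a \<Rightarrow> complex"
  assumes cinner_commute: "cinner x y = cnj (cinner y x)"
    and cinner_add_left: "cinner (x + y) z = cinner x z + cinner y z"
    and cinner_scaleC_left: "cinner (c *\<^sub>C x) y = c * cinner x y"
    and cinner_self: "cinner x x = complex_of_real ((norm x)\<^sup>2)"

instantiation complex :: complex_hilbert
begin

definition "c *\<^sub>C (x :: complex) = c * x"
definition "cinner (x :: complex) y = x * cnj y"

instance
  by standard
    (simp_all add: scaleC_complex_def cinner_complex_def algebra_simps scaleR_conv_of_real
      complex_norm_square del: of_real_power)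

end

instantiation prod :: (complex_vector, complex_vector) complex_vector
begin

definition "c *\<^sub>C (z :: 'a \<times> 'b) = (c *\<^sub>C fst z, c *\<^sub>C snd z)"

instance
  by standard
    (simp_all add: scaleC_prod_def scaleC_add_right scaleC_add_left scaleC_scaleC
      scaleR_scaleC prod_eq_iff)

end


section \<open>Unbounded operators\<close>

text \<open>An operator is a domain together with a function; the values of the function outside
  the domain are irrelevant.\<close>

datatype ('a, 'b) unbdd_op = Unbdd_Op (op_dom: "'a set") (op_app: "'a \<Rightarrow> 'b")

definition clinear_on :: "'a::complex_vector set \<Rightarrow> ('a \<Rightarrow> 'b::complex_vector) \<Rightarrow> bool" where
  "clinear_on V f \<longleftrightarrow> module.subspace scaleC V \<and>
     (\<forall>x\<in>V. \<forall>y\<in>V. f (x + y) = f x + f y) \<and> (\<forall>c. \<forall>x\<in>V. f (c *\<^sub>C x) = c *\<^sub>C f x)"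

text \<open>The last conjunct says that the graph of the adjoint equals the graph of the operator.\<close>

definition self_adjoint :: "('h::complex_hilbert, 'h) unbdd_op \<Rightarrow> bool" where
  "self_adjoint A \<longleftrightarrow>
     clinear_on (op_dom A) (op_app A) \<and> closure (op_dom A) = UNIV \<and>
     (\<forall>v w. (\<forall>u\<in>op_dom A. cinner (op_app A u) v = cinner u w) \<longleftrightarrow>
            (v \<in> op_dom A \<and> w = op_app A v))"

definition positive_op :: "('h::complex_hilbert, 'h) unbdd_op \<Rightarrow> bool" where
  "positive_op A \<longleftrightarrow> (\<forall>u\<in>op_dom A - {0}. 0 < Re (cinner (op_app A u) u))"

definition unbounded_op :: "('h::complex_hilbert, 'h) unbdd_op \<Rightarrow> bool" where
  "unbounded_op A \<longleftrightarrow> \<not> (\<exists>K. \<forall>u\<in>op_dom A. norm (op_app A u) \<le> K * norm u)"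

definition is_resolvent ::
  "('h::complex_hilbert, 'h) unbdd_op \<Rightarrow> complex \<Rightarrow> ('h \<Rightarrow> 'h) \<Rightarrow> bool" where
  "is_resolvent A \<zeta> R \<longleftrightarrow> bounded_linear R \<and>
     (\<forall>w. R w \<in> op_dom A \<and> op_app A (R w) - \<zeta> *\<^sub>C R w = w) \<and>
     (\<forall>u\<in>op_dom A. R (op_app A u - \<zeta> *\<^sub>C u) = u)"

definition compact_map :: "('h::complex_hilbert \<Rightarrow> 'h) \<Rightarrow> bool" where
  "compact_map R \<longleftrightarrow> (\<forall>B. bounded B \<longrightarrow> compact (closure (R ` B)))"

definition compact_resolvent :: "('h::complex_hilbert, 'h) unbdd_op \<Rightarrow> bool" where
  "compact_resolvent A \<longleftrightarrow> (\<exists>\<zeta> R. is_resolvent A \<zeta> R \<and> compact_map R)"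

text \<open>\<open>S = A\<^sup>1\<^sup>/\<^sup>2\<close>: for positive self-adjoint \<open>A\<close>, the square root is the unique positive
  self-adjoint \<open>S\<close> with \<open>S \<circ> S = A\<close>, equality of domains included.\<close>

definition is_sqrt_op ::
  "('h::complex_hilbert, 'h) unbdd_op \<Rightarrow> ('h, 'h) unbdd_op \<Rightarrow> bool" where
  "is_sqrt_op S A \<longleftrightarrow> self_adjoint S \<and> positive_op S \<and>
     op_dom A = {u \<in> op_dom S. op_app S u \<in> op_dom S} \<and>
     (\<forall>u\<in>op_dom A. op_app A u = op_app S (op_app S u))"

text \<open>Sequences indexed by the positive integers are functions on \<^typ>\<open>nat\<close> whose value
  at \<open>0\<close> is ignored.\<close>

definition orthonormal_basis :: "(nat \<Rightarrow> 'h::complex_hilbert) \<Rightarrow> bool" where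
  "orthonormal_basis \<phi> \<longleftrightarrow>
     (\<forall>j\<ge>1. \<forall>k\<ge>1. cinner (\<phi> j) (\<phi> k) = (if j = k then 1 else 0)) \<and>
     closure (module.span scaleC (\<phi> ` {1..})) = UNIV"

definition eigenbasis ::
  "('h::complex_hilbert, 'h) unbdd_op \<Rightarrow> (nat \<Rightarrow> real) \<Rightarrow> (nat \<Rightarrow> 'h) \<Rightarrow> bool" where
  "eigenbasis S lam \<phi> \<longleftrightarrow> mono_on {1..} lam \<and> orthonormal_basis \<phi> \<and>
     (\<forall>k\<ge>1. \<phi> k \<in> op_dom S \<and> op_app S (\<phi> k) = lam k *\<^sub>R \<phi> k)"

text \<open>Boundedness from \<open>D(A)\<close> to \<open>Y\<close>, where \<open>D(A)\<close> carries the norm \<open>\<parallel>A u\<parallel>\<close>.\<close>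

definition bounded_from_dom ::
  "('h::complex_hilbert, 'h) unbdd_op \<Rightarrow> ('h \<Rightarrow> 'y::complex_hilbert) \<Rightarrow> bool" where
  "bounded_from_dom A C \<longleftrightarrow> clinear_on (op_dom A) C \<and>
     (\<exists>K. \<forall>u\<in>op_dom A. norm (C u) \<le> K * norm (op_app A u))"

text \<open>\<open>U\<close> is a strongly continuous group of isometries, with infinitesimal generator \<open>G\<close>,
  on the space with underlying set \<open>V\<close> and norm \<open>N\<close>.\<close>

definition isometry_group_generated_by ::
  "'x::complex_vector set \<Rightarrow> ('x \<Rightarrow> real) \<Rightarrow> ('x, 'x) unbdd_op \<Rightarrow> (real \<Rightarrow> 'x \<Rightarrow> 'x) \<Rightarrow> bool" where
  "isometry_group_generated_by V N G U \<longleftrightarrow>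
     (\<forall>t. clinear_on V (U t) \<and> (\<forall>z\<in>V. U t z \<in> V \<and> N (U t z) = N z)) \<and>
     (\<forall>z\<in>V. U 0 z = z) \<and> (\<forall>s t. \<forall>z\<in>V. U (s + t) z = U s (U t z)) \<and>
     (\<forall>z\<in>V. ((\<lambda>t. N (U t z - z)) \<longlongrightarrow> 0) (at 0)) \<and>
     (\<forall>z\<in>V. \<forall>w\<in>V. ((\<lambda>t. N ((1 / t) *\<^sub>R (U t z - z) - w)) \<longlongrightarrow> 0) (at 0) \<longleftrightarrow>
                    (z \<in> op_dom G \<and> w = op_app G z))"


section \<open>The first-order system\<close>

text \<open>In the following \<open>S\<close> is the square root of \<open>A0\<close>, so that \<open>H\<^sub>1 = op_dom S\<close>.\<close>

definition X_space :: "('h::complex_hilbert, 'h) unbdd_op \<Rightarrow> ('h \<times> 'h) set" where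
  "X_space S = op_dom S \<times> UNIV"

definition X_inner ::
  "('h::complex_hilbert, 'h) unbdd_op \<Rightarrow> 'h \<times> 'h \<Rightarrow> 'h \<times> 'h \<Rightarrow> complex" where
  "X_inner S z w =
     cinner (op_app S (fst z)) (op_app S (fst w)) + cinner (snd z) (snd w)"

definition X_norm :: "('h::complex_hilbert, 'h) unbdd_op \<Rightarrow> 'h \<times> 'h \<Rightarrow> real" where
  "X_norm S z = sqrt ((norm (op_app S (fst z)))\<^sup>2 + (norm (snd z))\<^sup>2)"

definition A_op ::
  "('h::complex_hilbert, 'h) unbdd_op \<Rightarrow> ('h, 'h) unbdd_op \<Rightarrow> ('h \<times> 'h, 'h \<times> 'h) unbdd_op" where
  "A_op A0 S = Unbdd_Op (op_dom A0 \<times> op_dom S)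
     (\<lambda>z. (- (\<i> *\<^sub>C snd z), \<i> *\<^sub>C op_app A0 (fst z)))"

definition iA_op ::
  "('h::complex_hilbert, 'h) unbdd_op \<Rightarrow> ('h, 'h) unbdd_op \<Rightarrow> ('h \<times> 'h, 'h \<times> 'h) unbdd_op" where
  "iA_op A0 S = Unbdd_Op (op_dom (A_op A0 S)) (\<lambda>z. \<i> *\<^sub>C op_app (A_op A0 S) z)"

definition C_op :: "('h \<Rightarrow> 'y) \<Rightarrow> 'h \<times> 'h \<Rightarrow> 'y" where
  "C_op C0 z = C0 (fst z)"

definition is_exp_itA ::
  "('h::complex_hilbert, 'h) unbdd_op \<Rightarrow> ('h, 'h) unbdd_op \<Rightarrow> (real \<Rightarrow> 'h \<times> 'h \<Rightarrow> 'h \<times> 'h) \<Rightarrow> bool"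
where
  "is_exp_itA A0 S U \<longleftrightarrow>
     isometry_group_generated_by (X_space S) (X_norm S) (iA_op A0 S) U"

definition admissible ::
  "('h::complex_hilbert, 'h) unbdd_op \<Rightarrow> ('h, 'h) unbdd_op \<Rightarrow> ('h \<Rightarrow> 'y::complex_hilbert) \<Rightarrow>
   (real \<Rightarrow> 'h \<times> 'h \<Rightarrow> 'h \<times> 'h) \<Rightarrow> bool" where
  "admissible A0 S C0 U \<longleftrightarrow>
     (\<forall>T>0. \<exists>K>0. \<forall>z\<in>op_dom (A_op A0 S).
        integral {0..T} (\<lambda>t. (norm (C_op C0 (U t z)))\<^sup>2) \<le> K * (X_norm S z)\<^sup>2)"

definition eigval_A :: "(nat \<Rightarrow> real) \<Rightarrow> int \<Rightarrow> real" where
  "eigval_A lam k = sgn (real_of_int k) * lam (nat \<bar>k\<bar>)"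

definition eigvec_A ::
  "(nat \<Rightarrow> real) \<Rightarrow> (nat \<Rightarrow> 'h::complex_hilbert) \<Rightarrow> int \<Rightarrow> 'h \<times> 'h" where
  "eigvec_A lam \<phi> k = (1 / sqrt 2) *\<^sub>R
     ((1 / (\<i> * complex_of_real (eigval_A lam k))) *\<^sub>C \<phi> (nat \<bar>k\<bar>), \<phi> (nat \<bar>k\<bar>))"

definition freq_A ::
  "('h::complex_hilbert, 'h) unbdd_op \<Rightarrow> ('h, 'h) unbdd_op \<Rightarrow> 'h \<times> 'h \<Rightarrow> real" where
  "freq_A A0 S z = Re (X_inner S (op_app (A_op A0 S) z) z) / (X_norm S z)\<^sup>2"

definition freq_absA ::
  "('h::complex_hilbert, 'h) unbdd_op \<Rightarrow> (nat \<Rightarrow> real) \<Rightarrow> (nat \<Rightarrow> 'h) \<Rightarrow> 'h \<times> 'h \<Rightarrow> real" where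
  "freq_absA S lam \<phi> z =
     (\<Sum>\<^sub>\<infinity>k\<in>UNIV - {0}. lam (nat \<bar>k\<bar>) * (cmod (X_inner S z (eigvec_A lam \<phi> k)))\<^sup>2) /
     (\<Sum>\<^sub>\<infinity>k\<in>UNIV - {0}. (cmod (X_inner S z (eigvec_A lam \<phi> k)))\<^sup>2)"

definition Sigma_d :: "(real \<Rightarrow> real) set" where
  "Sigma_d = {f. (\<forall>x. 0 < f x) \<and> (\<forall>x. f (- x) = f x) \<and> continuous_on UNIV f \<and>
                 antimono_on {0..} f}"

definition Sigma_i :: "(real \<Rightarrow> real) set" where
  "Sigma_i = {f. (\<forall>x. 0 < f x) \<and> (\<forall>x. f (- x) = f x) \<and> continuous_on UNIV f \<and>
                 mono_on {0..} f}"

definition weakly_observable ::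
  "('h::complex_hilbert, 'h) unbdd_op \<Rightarrow> ('h, 'h) unbdd_op \<Rightarrow> (nat \<Rightarrow> real) \<Rightarrow> (nat \<Rightarrow> 'h) \<Rightarrow>
   ('h \<Rightarrow> 'y::complex_hilbert) \<Rightarrow> (real \<Rightarrow> 'h \<times> 'h \<Rightarrow> 'h \<times> 'h) \<Rightarrow> bool" where
  "weakly_observable A0 S lam \<phi> C0 U \<longleftrightarrow>
     (\<exists>T\<in>Sigma_i. \<exists>\<Psi>\<in>Sigma_d. \<forall>z\<in>op_dom (A_op A0 S) - {0}.
        \<Psi> (freq_absA S lam \<phi> z) * (X_norm S z)\<^sup>2 \<le>
        integral {0..T (freq_absA S lam \<phi> z)} (\<lambda>t. (norm (C_op C0 (U t z)))\<^sup>2))"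

end

theory Submission
  imports Defs
begin

text \<open>Both conclusions rest on one estimate for the first-order operator: there are
  \<open>a, b \<in> \<Sigma>\<^sub>i\<close> with
  \<open>\<parallel>z\<parallel>\<^sup>2 \<le> a \<mu> * \<parallel>C z\<parallel>\<^sup>2 + b \<mu> * \<parallel>(A - \<mu>) z\<parallel>\<^sup>2\<close> for all real \<open>\<mu>\<close> and all \<open>z\<close> in the domain
  (\<open>first_order_resolvent_estimate\<close>). It holds because the first component of \<open>z = (u, v)\<close> satisfies
  \<open>(A\<^sub>0 - \<mu>\<^sup>2) u = \<mu> f - i g\<close> when \<open>(f, g) = (A - \<mu>) z\<close>, so that the given inequality
  applies to \<open>u\<close>.

  For the resolvent inequality with frequency functions, \<open>A z - \<lambda>\<^sub>A(z) z\<close> is orthogonal to \<open>z\<close>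
  (\<open>shifted_norm_square\<close>). This accounts for the term \<open>(\<mu> - \<lambda>\<^sub>A(z))\<^sup>2\<close> and reduces the claim to
  \<open>\<mu> = \<lambda>\<^sub>A(z)\<close>, where the estimate applies with constants governed by
  \<open>|\<lambda>\<^sub>A(z)| \<le> \<lambda>\<^sub>|\<^sub>A\<^sub>|(z)\<close> (\<open>abs_freq_A_le\<close>).

  For weak observability, let \<open>\<Lambda> = \<lambda>\<^sub>|\<^sub>A\<^sub>|(z)\<close>. At least half of the mass of \<open>z\<close> lies in the finitely
  many modes of frequency at most \<open>2 \<Lambda>\<close>, so one of them, with eigenvalue \<open>\<mu>\<close>, carries a fixed
  proportion of it (\<open>exists_heavy_low_mode\<close>). The integral of \<open>e\<^sup>-\<^sup>i\<^sup>\<mu>\<^sup>t e\<^sup>i\<^sup>t\<^sup>A z\<close> over \<open>[0, T]\<close>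
  keeps \<open>T\<close> times this mode (\<open>mode_coeff_twisted_integral\<close>), while \<open>A - \<mu>\<close> maps it to a boundary
  term of norm at most \<open>2 \<parallel>z\<parallel>\<close> (\<open>twisted_integral_almost_eigenvector\<close>). The resolvent estimate at
  \<open>\<mu>\<close> then bounds its observation from below as soon as \<open>T\<close> is large, and by the Cauchy--Schwarz
  inequality the squared norm of that observation is at most \<open>T\<close> times the integral of
  \<open>\<parallel>C e\<^sup>i\<^sup>t\<^sup>A z\<parallel>\<^sup>2\<close> (\<open>observation_twisted_integral\<close>). The integral is taken in
  \<open>H \<times> H\<close>; it commutes with \<open>A\<close> because self-adjoint operators are closed, and with \<open>C\<close> because \<open>C\<close>
  is bounded for the graph norm (\<open>self_adjoint_integral\<close>, \<open>bounded_from_dom_integral\<close>).\<close>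

section \<open>Complex Hilbert spaces and orthonormal expansions\<close>

interpretation complex_vs: vector_space "scaleC :: complex \<Rightarrow> 'a \<Rightarrow> 'a::complex_vector"
  by (rule vector_space_scaleC)

lemma norm_scaleC: "norm (c *\<^sub>C x) = cmod c * norm x" for x :: "'a::complex_hilbert"
proof -
  have "complex_of_real ((norm (c *\<^sub>C x))\<^sup>2) = c * cnj c * complex_of_real ((norm x)\<^sup>2)"
    by (metis cinner_self cinner_scaleC_left cinner_commute complex_cnj_mult mult.assoc
        complex_cnj_cnj)
  also have "\<dots> = complex_of_real ((cmod c * norm x)\<^sup>2)"
    by (simp add: complex_norm_square[symmetric] power_mult_distrib)
  finally show ?thesis
    by (metis of_real_eq_iff norm_ge_zero power2_eq_imp_eq zero_le_mult_iff)
qed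

lemma norm_scaleC_prod: "norm (c *\<^sub>C z) = cmod c * norm z"
  for z :: "'a::complex_hilbert \<times> 'b::complex_hilbert"
  by (simp add: norm_prod_def scaleC_prod_def norm_scaleC power_mult_distrib
      distrib_left[symmetric] real_sqrt_mult del: distrib_left)

lemma scaleC_scaleR_commute: "c *\<^sub>C (r *\<^sub>R x) = r *\<^sub>R (c *\<^sub>C x)" for x :: "'a::complex_vector"
  by (simp only: scaleR_scaleC[of r] scaleC_scaleC mult.commute)

lemma bounded_bilinear_scaleC: "bounded_bilinear (scaleC :: complex \<Rightarrow> 'a \<Rightarrow> 'a::complex_hilbert)"
proof
  show "\<exists>K. \<forall>a b. norm (a *\<^sub>C (b::'a)) \<le> norm a * norm b * K"
    by (intro exI[of _ 1]) (simp add: norm_scaleC)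
next
  show "(r *\<^sub>R c) *\<^sub>C x = r *\<^sub>R (c *\<^sub>C x)" for r c and x :: 'a
    by (simp add: scaleR_conv_of_real scaleR_scaleC[where 'a = 'a] scaleC_scaleC)
qed (simp_all add: scaleC_add_left scaleC_add_right scaleC_scaleR_commute)

lemma cinner_add_right: "cinner x (y + z) = cinner x y + cinner x z"
  by (metis cinner_commute cinner_add_left complex_cnj_add)

lemma cinner_scaleC_right: "cinner x (c *\<^sub>C y) = cnj c * cinner x y"
  by (metis cinner_commute cinner_scaleC_left complex_cnj_mult)

lemma cinner_scaleR_left: "cinner (r *\<^sub>R x) y = r *\<^sub>R cinner x y"
  by (simp only: scaleR_scaleC[of r x] cinner_scaleC_left scaleR_conv_of_real)

lemma cinner_scaleR_right: "cinner x (r *\<^sub>R y) = r *\<^sub>R cinner x y"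
  by (simp only: scaleR_scaleC[of r y] cinner_scaleC_right scaleR_conv_of_real complex_cnj_complex_of_real)

lemma Re_cinner_self: "Re (cinner x x) = (norm x)\<^sup>2"
  by (simp add: cinner_self del: of_real_power)

lemma norm_add_square: "(norm (x + y))\<^sup>2 = (norm x)\<^sup>2 + (norm y)\<^sup>2 + 2 * Re (cinner x y)"
  for x y :: "'a::complex_hilbert"
proof -
  have "Re (cinner y x) = Re (cinner x y)"
    by (subst cinner_commute) simp
  then show ?thesis
    by (simp add: cinner_add_left cinner_add_right flip: Re_cinner_self)
qed

lemma Cauchy_Schwarz_cinner: "cmod (cinner x y) \<le> norm x * norm y"
proof (cases "cinner x y = 0 \<or> y = 0")
  case True
  then show ?thesis
    by (metis cinner_scaleR_right mult_nonneg_nonneg norm_ge_zero norm_zero scaleR_zero_left)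
next
  case False
  let ?c = "cinner x y"
  have y: "norm y > 0" using False by simp
  \<comment> \<open>The multiple of \<open>y\<close> that brings \<open>x + t y\<close> closest to \<open>0\<close>.\<close>
  define t where "t = - ?c / complex_of_real ((norm y)\<^sup>2)"
  have t: "cmod t = cmod ?c / (norm y)\<^sup>2"
    by (simp add: t_def norm_divide norm_power)
  have "cnj t * ?c = - complex_of_real ((cmod ?c)\<^sup>2 / (norm y)\<^sup>2)"
    unfolding t_def by (simp add: complex_norm_square mult.commute[of "cnj ?c"] del: of_real_power)
  then have "Re (cinner x (t *\<^sub>C y)) = - ((cmod ?c)\<^sup>2 / (norm y)\<^sup>2)"
    by (metis cinner_scaleC_right uminus_complex.sel(1) Re_complex_of_real)
  with norm_add_square[of x "t *\<^sub>C y"]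
  have "0 \<le> (norm x)\<^sup>2 + (cmod ?c / (norm y)\<^sup>2 * norm y)\<^sup>2 - 2 * ((cmod ?c)\<^sup>2 / (norm y)\<^sup>2)"
    by (metis norm_scaleC t zero_le_power2 mult_minus_right uminus_add_conv_diff add.commute)
  also have "\<dots> = (norm x)\<^sup>2 - (cmod ?c)\<^sup>2 / (norm y)\<^sup>2"
    using y by (simp add: field_simps power2_eq_square)
  finally have "(cmod ?c)\<^sup>2 \<le> (norm x * norm y)\<^sup>2"
    using y by (simp add: field_simps)
  then show ?thesis
    by (rule power2_le_imp_le) simp
qed

lemma bounded_bilinear_cinner: "bounded_bilinear cinner"
proof
  show "\<exists>K. \<forall>a b. norm (cinner a b) \<le> norm a * norm (b::'a) * K"
    by (intro exI[of _ 1]) (simp add: Cauchy_Schwarz_cinner)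
qed (simp_all add: cinner_add_left cinner_add_right cinner_scaleR_left cinner_scaleR_right)

lemmas cinner_diff_left = bounded_bilinear.diff_left[OF bounded_bilinear_cinner]
  and cinner_minus_left = bounded_bilinear.minus_left[OF bounded_bilinear_cinner]
  and cinner_minus_right = bounded_bilinear.minus_right[OF bounded_bilinear_cinner]
  and cinner_sum_left = bounded_bilinear.sum_left[OF bounded_bilinear_cinner]
  and tendsto_cinner = bounded_bilinear.tendsto[OF bounded_bilinear_cinner]
  and bounded_linear_cinner_left = bounded_bilinear.bounded_linear_left[OF bounded_bilinear_cinner]
  and bounded_linear_cinner_right = bounded_bilinear.bounded_linear_right[OF bounded_bilinear_cinner]

definition partial_expansion :: "(nat \<Rightarrow> 'h::complex_hilbert) \<Rightarrow> nat \<Rightarrow> 'h \<Rightarrow> 'h" where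
  "partial_expansion \<phi> n x = (\<Sum>k<n. cinner x (\<phi> (Suc k)) *\<^sub>C \<phi> (Suc k))"

lemma partial_expansion_add:
  "partial_expansion \<phi> n (x + y) = partial_expansion \<phi> n x + partial_expansion \<phi> n y"
  by (simp add: partial_expansion_def cinner_add_left scaleC_add_left sum.distrib)

lemma partial_expansion_scaleC:
  "partial_expansion \<phi> n (c *\<^sub>C x) = c *\<^sub>C partial_expansion \<phi> n x"
  by (simp add: partial_expansion_def cinner_scaleC_left scaleC_scaleC complex_vs.scale_sum_right)

text \<open>Bessel's inequality. A partial expansion \<open>P x\<close> is an orthogonal projection, so
  \<open>\<langle>P x, P x\<rangle> = \<langle>P x, x\<rangle>\<close>, and the Cauchy--Schwarz inequality bounds the right-hand side.\<close>

lemma norm_partial_expansion_le: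
  assumes "orthonormal_basis \<phi>"
  shows "norm (partial_expansion \<phi> n x) \<le> norm x"
proof -
  let ?P = "partial_expansion \<phi> n x"
  have on: "cinner (\<phi> (Suc j)) (\<phi> (Suc k)) = (if j = k then 1 else 0)" for j k
    using assms by (simp add: orthonormal_basis_def)
  have "cinner ?P (\<phi> (Suc k)) = cinner x (\<phi> (Suc k))" if "k < n" for k
    using that
    by (simp add: partial_expansion_def cinner_sum_left cinner_scaleC_left on if_distrib cong: if_cong)
  then have "cinner (\<phi> (Suc k)) ?P = cinner (\<phi> (Suc k)) x" if "k < n" for k
    by (metis that cinner_commute)
  then have "cinner ?P ?P = cinner ?P x"
    by (subst (1 3) partial_expansion_def) (simp add: cinner_sum_left cinner_scaleC_left)
  then have "(norm ?P)\<^sup>2 \<le> norm ?P * norm x"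
    by (metis Cauchy_Schwarz_cinner cinner_self norm_of_real abs_of_nonneg zero_le_power2)
  then show ?thesis
    by (cases "norm ?P = 0") (auto simp: power2_eq_square)
qed

text \<open>The vectors whose expansions converge form a closed subspace: closedness holds because the
  partial expansions are contractions.\<close>

lemma partial_expansion_tendsto:
  assumes "orthonormal_basis \<phi>"
  shows "(\<lambda>n. partial_expansion \<phi> n x) \<longlonglongrightarrow> x"
proof (rule tendstoI)
  fix e :: real assume e: "e > 0"
  have fin: "(\<lambda>n. partial_expansion \<phi> n s) \<longlonglongrightarrow> s" if "s \<in> module.span scaleC (\<phi> ` {1..})" for s
    using that
  proof (rule complex_vs.span_induct)
    show "complex_vs.subspace {s. (\<lambda>n. partial_expansion \<phi> n s) \<longlonglongrightarrow> s}"
    proof (rule complex_vs.subspaceI)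
      show "0 \<in> {s. (\<lambda>n. partial_expansion \<phi> n s) \<longlonglongrightarrow> s}"
        using partial_expansion_scaleC[of \<phi> _ 0 0] by simp
    qed (simp_all add: partial_expansion_add partial_expansion_scaleC tendsto_add
        bounded_linear.tendsto[OF bounded_bilinear.bounded_linear_right[OF bounded_bilinear_scaleC]])
  next
    fix s assume "s \<in> \<phi> ` {1..}"
    then obtain j where s: "s = \<phi> (Suc j)"
      by (metis imageE atLeast_iff Suc_le_D One_nat_def)
    have "partial_expansion \<phi> n s = s" if "n \<ge> Suc j" for n
    proof -
      have "partial_expansion \<phi> n s = (\<Sum>k<n. if j = k then \<phi> (Suc k) else 0)"
        using assms unfolding partial_expansion_def s
        by (intro sum.cong) (auto simp: orthonormal_basis_def)
      then show ?thesis using that by (simp add: s)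
    qed
    then show "(\<lambda>n. partial_expansion \<phi> n s) \<longlonglongrightarrow> s"
      by (intro tendsto_eventually eventually_sequentiallyI)
  qed
  have "x \<in> closure (module.span scaleC (\<phi> ` {1..}))"
    using assms by (simp add: orthonormal_basis_def)
  then obtain s where s: "s \<in> module.span scaleC (\<phi> ` {1..})" "norm (x - s) < e / 4"
    using e by (force simp: closure_approachable dist_norm norm_minus_commute dest!: spec[of _ "e/4"])
  have "\<forall>\<^sub>F n in sequentially. norm (partial_expansion \<phi> n s - s) < e / 4"
    using tendstoD[OF fin[OF s(1)], of "e/4"] e by (simp add: dist_norm)
  then show "\<forall>\<^sub>F n in sequentially. dist (partial_expansion \<phi> n x) x < e"
  proof eventually_elim
    case (elim n)
    have eq: "partial_expansion \<phi> n x - x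
        = partial_expansion \<phi> n (x - s) + (partial_expansion \<phi> n s - s) + (s - x)"
      using partial_expansion_add[of \<phi> n "x - s" s] by simp
    have "norm (partial_expansion \<phi> n x - x) \<le> norm (partial_expansion \<phi> n (x - s))
        + norm (partial_expansion \<phi> n s - s) + norm (s - x)"
      unfolding eq by (intro norm_triangle_le add_mono) auto
    then show ?case
      using norm_partial_expansion_le[OF assms, of n "x - s"] s(2) elim e
      by (simp add: dist_norm norm_minus_commute)
  qed
qed

lemma Parseval_sums:
  assumes "orthonormal_basis \<phi>"
  shows "(\<lambda>k. cinner x (\<phi> (Suc k)) * cinner (\<phi> (Suc k)) y) sums cinner x y"
  unfolding sums_def
  using tendsto_cinner[OF partial_expansion_tendsto[OF assms, of x] tendsto_const[of y]]
  by (simp add: partial_expansion_def cinner_sum_left cinner_scaleC_left)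

section \<open>Self-adjoint operators under the integral sign\<close>

lemma clinear_on_simps:
  assumes "clinear_on V f"
  shows "0 \<in> V" and "f 0 = 0"
    and "x \<in> V \<Longrightarrow> y \<in> V \<Longrightarrow> x + y \<in> V" and "x \<in> V \<Longrightarrow> y \<in> V \<Longrightarrow> f (x + y) = f x + f y"
    and "x \<in> V \<Longrightarrow> c *\<^sub>C x \<in> V" and "x \<in> V \<Longrightarrow> f (c *\<^sub>C x) = c *\<^sub>C f x"
    and "x \<in> V \<Longrightarrow> r *\<^sub>R x \<in> V" and "x \<in> V \<Longrightarrow> f (r *\<^sub>R x) = r *\<^sub>R f x"
    and "x \<in> V \<Longrightarrow> - x \<in> V" and "x \<in> V \<Longrightarrow> f (- x) = - f x"
    and "x \<in> V \<Longrightarrow> y \<in> V \<Longrightarrow> x - y \<in> V" and "x \<in> V \<Longrightarrow> y \<in> V \<Longrightarrow> f (x - y) = f x - f y"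
proof -
  have V: "complex_vs.subspace V"
    and add: "\<And>x y. x \<in> V \<Longrightarrow> y \<in> V \<Longrightarrow> f (x + y) = f x + f y"
    and sc: "\<And>c x. x \<in> V \<Longrightarrow> f (c *\<^sub>C x) = c *\<^sub>C f x"
    using assms by (auto simp: clinear_on_def)
  show z: "0 \<in> V" and "x \<in> V \<Longrightarrow> y \<in> V \<Longrightarrow> x + y \<in> V"
    and scV: "x \<in> V \<Longrightarrow> c *\<^sub>C x \<in> V" for x y c
    using V by (auto intro: complex_vs.subspace_0 complex_vs.subspace_add complex_vs.subspace_scale)
  show mV: "x \<in> V \<Longrightarrow> - x \<in> V" and "x \<in> V \<Longrightarrow> y \<in> V \<Longrightarrow> x - y \<in> V" for x y
    using V by (auto intro: complex_vs.subspace_neg complex_vs.subspace_diff)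
  show "x \<in> V \<Longrightarrow> r *\<^sub>R x \<in> V" for x
    using scV by (simp only: scaleR_scaleC)
  show "x \<in> V \<Longrightarrow> y \<in> V \<Longrightarrow> f (x + y) = f x + f y" "x \<in> V \<Longrightarrow> f (c *\<^sub>C x) = c *\<^sub>C f x"
    by (fact add sc)+
  show "x \<in> V \<Longrightarrow> f (r *\<^sub>R x) = r *\<^sub>R f x"
    using sc by (simp only: scaleR_scaleC)
  show "f 0 = 0"
    using sc[OF z, of 0] by simp
  have m: "f (- x) = - f x" if "x \<in> V" for x
    using sc[OF that, of "-1"] by simp
  then show "x \<in> V \<Longrightarrow> f (- x) = - f x" .
  show "x \<in> V \<Longrightarrow> y \<in> V \<Longrightarrow> f (x - y) = f x - f y"
    using add[OF _ mV, of x y] m[of y] by simp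
qed

lemma self_adjoint_clinear: "self_adjoint B \<Longrightarrow> clinear_on (op_dom B) (op_app B)"
  by (simp add: self_adjoint_def)

lemma self_adjoint_symmetric:
  "self_adjoint B \<Longrightarrow> u \<in> op_dom B \<Longrightarrow> v \<in> op_dom B \<Longrightarrow>
    cinner (op_app B u) v = cinner u (op_app B v)"
  unfolding self_adjoint_def by blast

text \<open>A self-adjoint operator is closed, being an adjoint, so it commutes with the integral of a
  curve that is continuous for the graph norm.\<close>

lemma self_adjoint_integral:
  fixes q :: "real \<Rightarrow> 'h::complex_hilbert"
  assumes B: "self_adjoint B" and q: "continuous_on {a..b} q"
    and Bq: "continuous_on {a..b} (\<lambda>t. op_app B (q t))"
    and dom: "\<And>t. t \<in> {a..b} \<Longrightarrow> q t \<in> op_dom B"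
  shows "integral {a..b} q \<in> op_dom B"
    and "op_app B (integral {a..b} q) = integral {a..b} (\<lambda>t. op_app B (q t))"
proof -
  have pull: "cinner u (integral {a..b} g) = integral {a..b} (\<lambda>t. cinner u (g t))"
    if "continuous_on {a..b} g" for u and g :: "real \<Rightarrow> 'h"
    using integral_linear[OF integrable_continuous_interval[OF that] bounded_linear_cinner_right]
    by (simp add: o_def)
  have "cinner (op_app B u) (integral {a..b} q) = cinner u (integral {a..b} (\<lambda>t. op_app B (q t)))"
    if "u \<in> op_dom B" for u
    unfolding pull[OF q] pull[OF Bq]
    by (intro integral_cong self_adjoint_symmetric[OF B that] dom)
  then have "integral {a..b} q \<in> op_dom B \<and>
      integral {a..b} (\<lambda>t. op_app B (q t)) = op_app B (integral {a..b} q)"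
    using B unfolding self_adjoint_def by blast
  then show "integral {a..b} q \<in> op_dom B"
    and "op_app B (integral {a..b} q) = integral {a..b} (\<lambda>t. op_app B (q t))"
    by simp_all
qed

text \<open>An operator that is bounded for the graph norm need not be closable in the ambient space.
  It commutes with the integral because it maps the primitive, which is differentiable for the
  graph norm, to a differentiable curve.\<close>

lemma bounded_from_dom_integral:
  fixes q :: "real \<Rightarrow> 'h::complex_hilbert"
  assumes B: "self_adjoint B" and C: "bounded_from_dom B C" and "0 \<le> T"
    and q: "continuous_on {0..T} q"
    and Bq: "continuous_on {0..T} (\<lambda>t. op_app B (q t))"
    and dom: "\<And>t. t \<in> {0..T} \<Longrightarrow> q t \<in> op_dom B"
  shows "continuous_on {0..T} (\<lambda>t. C (q t))"
    and "C (integral {0..T} q) = integral {0..T} (\<lambda>t. C (q t))"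
proof -
  note linB = clinear_on_simps[OF self_adjoint_clinear[OF B]]
  have Clin: "clinear_on (op_dom B) C"
    using C by (simp add: bounded_from_dom_def)
  note linC = clinear_on_simps[OF Clin]
  obtain K where K: "norm (C u) \<le> K * norm (op_app B u)" if "u \<in> op_dom B" for u
    using C by (auto simp: bounded_from_dom_def)
  have K': "norm (C u) \<le> \<bar>K\<bar> * norm (op_app B u)" if "u \<in> op_dom B" for u
    using K[OF that] by (meson abs_ge_self mult_right_mono norm_ge_zero order_trans)
  show cont: "continuous_on {0..T} (\<lambda>t. C (q t))"
    unfolding continuous_on_def
  proof
    fix s assume s: "s \<in> {0..T}"
    have "((\<lambda>t. \<bar>K\<bar> * norm (op_app B (q t) - op_app B (q s))) \<longlongrightarrow> \<bar>K\<bar> * norm (op_app B (q s) - op_app B (q s)))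
        (at s within {0..T})"
      using Bq s unfolding continuous_on_def by (intro tendsto_intros) auto
    then have lim: "((\<lambda>t. \<bar>K\<bar> * norm (op_app B (q t) - op_app B (q s))) \<longlongrightarrow> 0) (at s within {0..T})"
      by simp
    have "((\<lambda>t. C (q t) - C (q s)) \<longlongrightarrow> 0) (at s within {0..T})"
    proof (rule Lim_null_comparison[OF _ lim])
      have "norm (C (q t) - C (q s)) \<le> \<bar>K\<bar> * norm (op_app B (q t) - op_app B (q s))"
        if "t \<in> {0..T}" for t
        using K'[OF linB(11)[OF dom[OF that] dom[OF s]]]
        by (simp only: linB(12)[OF dom[OF that] dom[OF s]] linC(12)[OF dom[OF that] dom[OF s]])
      then show "\<forall>\<^sub>F t in at s within {0..T}. norm (C (q t) - C (q s))
          \<le> \<bar>K\<bar> * norm (op_app B (q t) - op_app B (q s))"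
        by (auto simp: eventually_at_filter intro!: always_eventually)
    qed
    then show "((\<lambda>t. C (q t)) \<longlongrightarrow> C (q s)) (at s within {0..T})"
      by (simp add: LIM_zero_iff)
  qed
  define F where "F s = integral {0..s} q" for s
  have F: "F s \<in> op_dom B" "op_app B (F s) = integral {0..s} (\<lambda>t. op_app B (q t))"
    if "s \<in> {0..T}" for s
    unfolding F_def using that
    by (auto intro!: self_adjoint_integral[OF B] dom intro: continuous_on_subset[OF q]
        continuous_on_subset[OF Bq])
  have "((\<lambda>s. C (F s)) has_vector_derivative C (q s)) (at s within {0..T})" if s: "s \<in> {0..T}" for s
  proof -
    have "((\<lambda>s. integral {0..s} (\<lambda>t. op_app B (q t))) has_vector_derivative op_app B (q s))
        (at s within {0..T})"
      by (rule integral_has_vector_derivative[OF Bq s])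
    then have "((\<lambda>s. op_app B (F s)) has_vector_derivative op_app B (q s)) (at s within {0..T})"
      by (rule has_vector_derivative_transform[OF s F(2), rotated])
    then have "((\<lambda>y. norm (op_app B (F y) - op_app B (F s) - (y - s) *\<^sub>R op_app B (q s)) / norm (y - s))
        \<longlongrightarrow> 0) (at s within {0..T})"
      unfolding has_vector_derivative_def has_derivative_iff_norm by blast
    then have lim: "((\<lambda>y. \<bar>K\<bar> * (norm (op_app B (F y) - op_app B (F s) - (y - s) *\<^sub>R op_app B (q s)) / norm (y - s)))
        \<longlongrightarrow> 0) (at s within {0..T})"
      by (rule tendsto_mult_right_zero)
    have "((\<lambda>y. norm (C (F y) - C (F s) - (y - s) *\<^sub>R C (q s)) / norm (y - s)) \<longlongrightarrow> 0) (at s within {0..T})"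
    proof (rule Lim_null_comparison[OF _ lim])
      have "norm (C (F y) - C (F s) - (y - s) *\<^sub>R C (q s))
        \<le> \<bar>K\<bar> * norm (op_app B (F y) - op_app B (F s) - (y - s) *\<^sub>R op_app B (q s))"
        if "y \<in> {0..T}" for y
      proof -
        have "F y - F s - (y - s) *\<^sub>R q s \<in> op_dom B"
          by (intro linB(7) linB(11) F(1) dom that s)
        from K'[OF this] show ?thesis
          using F(1)[OF that] F(1)[OF s] dom[OF s] by (simp add: linB linC)
      qed
      then show "\<forall>\<^sub>F y in at s within {0..T}.
          norm (norm (C (F y) - C (F s) - (y - s) *\<^sub>R C (q s)) / norm (y - s))
          \<le> \<bar>K\<bar> * (norm (op_app B (F y) - op_app B (F s) - (y - s) *\<^sub>R op_app B (q s)) / norm (y - s))"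
        by (auto simp: eventually_at_filter divide_right_mono intro!: always_eventually)
    qed
    then show ?thesis
      unfolding has_vector_derivative_def has_derivative_iff_norm
      by (simp add: bounded_linear_scaleR_left)
  qed
  then have "((\<lambda>t. C (q t)) has_integral C (F T) - C (F 0)) {0..T}"
    using \<open>0 \<le> T\<close> by (intro fundamental_theorem_of_calculus)
  moreover have "C (F 0) = 0"
    by (simp add: F_def linC)
  ultimately show "C (integral {0..T} q) = integral {0..T} (\<lambda>t. C (q t))"
    by (simp add: F_def integral_unique)
qed

text \<open>The Cauchy--Schwarz inequality in time. With \<open>I\<close> the integral of the norm, it says that the
  integral of \<open>(T \<parallel>g\<parallel> - I)\<^sup>2\<close> is nonnegative.\<close>

lemma norm_integral_power2_le:
  fixes g :: "real \<Rightarrow> 'a::banach"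
  assumes g: "continuous_on {0..T} g" and "0 < T"
  shows "(norm (integral {0..T} g))\<^sup>2 \<le> T * integral {0..T} (\<lambda>t. (norm (g t))\<^sup>2)"
proof -
  define I where "I = integral {0..T} (\<lambda>t. norm (g t))"
  have int: "(\<lambda>t. norm (g t)) integrable_on {0..T}" "(\<lambda>t. (norm (g t))\<^sup>2) integrable_on {0..T}"
    using g by (auto intro!: integrable_continuous_interval continuous_intros)
  have "((\<lambda>t. T\<^sup>2 * (norm (g t))\<^sup>2 - (2 * T * I) * norm (g t) + I\<^sup>2) has_integral
      T\<^sup>2 * integral {0..T} (\<lambda>t. (norm (g t))\<^sup>2) - (2 * T * I) * I + T * I\<^sup>2) {0..T}"
    using int \<open>0 < T\<close> has_integral_const_real[of "I\<^sup>2" 0 T] unfolding I_def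
    by (intro has_integral_add has_integral_diff has_integral_mult_right integrable_integral) auto
  moreover have "0 \<le> T\<^sup>2 * (norm (g t))\<^sup>2 - (2 * T * I) * norm (g t) + I\<^sup>2" for t
    using zero_le_power2[of "T * norm (g t) - I"] by (simp add: power2_eq_square algebra_simps)
  ultimately have "0 \<le> T\<^sup>2 * integral {0..T} (\<lambda>t. (norm (g t))\<^sup>2) - (2 * T * I) * I + T * I\<^sup>2"
    by (rule has_integral_nonneg)
  then have "0 \<le> T * (T * integral {0..T} (\<lambda>t. (norm (g t))\<^sup>2) - I\<^sup>2)"
    by (simp add: power2_eq_square algebra_simps)
  then have "I\<^sup>2 \<le> T * integral {0..T} (\<lambda>t. (norm (g t))\<^sup>2)"
    using \<open>0 < T\<close> by (simp add: zero_le_mult_iff)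
  moreover have "norm (integral {0..T} g) \<le> I"
    unfolding I_def
    by (rule integral_norm_bound_integral[OF integrable_continuous_interval[OF g] int(1)]) simp
  ultimately show ?thesis
    by (meson norm_ge_zero order_trans power_mono)
qed

section \<open>Rate functions\<close>

text \<open>The moving average over \<open>[x, x + 1]\<close> turns a step function into a continuous one and
  keeps monotonicity.\<close>

lemma continuous_majorant_in_Sigma_i:
  fixes G :: "real \<Rightarrow> real"
  assumes G: "mono_on {0..} G" and nonneg: "\<And>x. 0 \<le> G x"
  obtains F where "F \<in> Sigma_i" and "\<And>x. 1 \<le> F x" and "\<And>x. 0 \<le> x \<Longrightarrow> G x \<le> F x"
proof
  \<comment> \<open>The integral over \<open>{0..1}\<close> makes monotonicity evident, its translate over
    \<open>{x..x + 1}\<close> makes continuity evident; the summand \<open>1\<close> gives positivity.\<close>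
  define F where "F x = 1 + integral {0..1} (\<lambda>t. G (t + \<bar>x\<bar>))" for x
  have int: "G integrable_on {a..b}" if "0 \<le> a" for a b
    by (rule integrable_on_mono_on) (use G that in \<open>auto intro: mono_on_subset\<close>)
  have shift: "integral {0..1} (\<lambda>t. G (t + y)) = integral {y..y+1} G" for y
    using integral_shift_Icc_real[of 0 1 G y] by (simp add: o_def add.commute)
  have int': "(\<lambda>t. G (t + y)) integrable_on {0..1}" if "0 \<le> y" for y
    by (rule integrable_on_mono_on) (use G that in \<open>auto simp: monotone_on_def\<close>)
  show F1: "1 \<le> F x" for x
    by (simp add: F_def integral_nonneg[OF int'] nonneg)
  have mono: "F x \<le> F y" if "0 \<le> x" "x \<le> y" for x y
    unfolding F_def using that G
    by (auto intro!: integral_le int' simp: monotone_on_def)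
  define H where "H y = integral {0..y} G" for y
  have H: "continuous_on {0..} H"
    unfolding continuous_on_eq_continuous_within
  proof
    fix x :: real assume "x \<in> {0..}"
    then have x: "x \<in> {0..x + 1}" by simp
    have "continuous (at x within {0..x + 1}) H"
      using indefinite_integral_continuous_1[OF int[of 0 "x + 1"]] x
      unfolding H_def continuous_on_eq_continuous_within by blast
    moreover have "at x within {0..x + 1} = at x within {0..}"
      by (rule at_within_nhd[of _ "{..<x + 1}"]) auto
    ultimately show "continuous (at x within {0..}) H"
      by (simp add: continuous_within)
  qed
  have "F x = 1 + (H (\<bar>x\<bar> + 1) - H \<bar>x\<bar>)" for x
    using Henstock_Kurzweil_Integration.integral_combine[of 0 "\<bar>x\<bar>" "\<bar>x\<bar> + 1" G] int[of 0 "\<bar>x\<bar> + 1"]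
    by (simp add: F_def shift H_def)
  moreover have "continuous_on UNIV (\<lambda>x::real. 1 + (H (\<bar>x\<bar> + 1) - H \<bar>x\<bar>))"
    by (intro continuous_intros continuous_on_compose2[OF H]) auto
  ultimately have "continuous_on UNIV F"
    by (simp cong: continuous_on_cong)
  moreover have "F (- x) = F x" for x
    by (simp add: F_def)
  moreover have "0 < F x" for x
    using F1[of x] by simp
  ultimately show "F \<in> Sigma_i"
    using mono by (auto simp: Sigma_i_def monotone_on_def)
  show "G x \<le> F x" if "0 \<le> x" for x
  proof -
    have "integral {0..1} (\<lambda>t::real. G x) \<le> integral {0..1} (\<lambda>t. G (t + \<bar>x\<bar>))"
      by (rule integral_le) (use G that int'[of x] in \<open>auto simp: monotone_on_def\<close>)
    then show ?thesis by (simp add: F_def)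
  qed
qed

lemma Sigma_i_le:
  assumes "f \<in> Sigma_i" "\<bar>x\<bar> \<le> \<bar>y\<bar>" shows "f x \<le> f y"
proof -
  have "f \<bar>x\<bar> \<le> f \<bar>y\<bar>"
    using assms by (auto simp: Sigma_i_def monotone_on_def)
  moreover have "f \<bar>x\<bar> = f x" "f \<bar>y\<bar> = f y"
    using assms(1) by (auto simp: Sigma_i_def abs_if)
  ultimately show ?thesis by simp
qed

lemma Sigma_i_pos: "f \<in> Sigma_i \<Longrightarrow> 0 < f x"
  by (simp add: Sigma_i_def)

lemma Sigma_i_const: "0 < c \<Longrightarrow> (\<lambda>x. c) \<in> Sigma_i"
  by (simp add: Sigma_i_def monotone_on_def)

lemma Sigma_i_add: "f \<in> Sigma_i \<Longrightarrow> g \<in> Sigma_i \<Longrightarrow> (\<lambda>x. f x + g x) \<in> Sigma_i"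
  by (auto simp: Sigma_i_def monotone_on_def intro!: add_mono continuous_intros add_pos_pos)

lemma Sigma_i_mult: "f \<in> Sigma_i \<Longrightarrow> g \<in> Sigma_i \<Longrightarrow> (\<lambda>x. f x * g x) \<in> Sigma_i"
  by (auto simp: Sigma_i_def monotone_on_def less_imp_le intro: mult_mono continuous_on_mult)

lemma Sigma_i_sqrt: "f \<in> Sigma_i \<Longrightarrow> (\<lambda>x. sqrt (f x)) \<in> Sigma_i"
  by (auto simp: Sigma_i_def monotone_on_def intro!: continuous_intros)

lemma Sigma_i_dilation:
  assumes f: "f \<in> Sigma_i" and "0 < c" shows "(\<lambda>x. f (c * x)) \<in> Sigma_i"
proof -
  have "continuous_on UNIV f"
    using f by (simp add: Sigma_i_def)
  then have "continuous_on UNIV (\<lambda>x. f (c * x))"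
    using continuous_on_compose2[OF _ continuous_on_mult_left[OF continuous_on_id, of UNIV c]]
    by blast
  then show ?thesis
    using assms by (auto simp: Sigma_i_def monotone_on_def)
qed

lemma Sigma_i_one_plus_square: "0 < c \<Longrightarrow> (\<lambda>x. 1 + x\<^sup>2 / c) \<in> Sigma_i"
  by (auto simp: Sigma_i_def monotone_on_def intro!: continuous_intros divide_right_mono power_mono
      add_pos_nonneg)

lemma Sigma_i_divide: "f \<in> Sigma_d \<Longrightarrow> 0 < c \<Longrightarrow> (\<lambda>x. c / f x) \<in> Sigma_i"
  by (auto simp: Sigma_i_def Sigma_d_def monotone_on_def less_imp_le less_imp_neq[symmetric]
      intro!: continuous_intros divide_left_mono)

lemma Sigma_d_divide: "f \<in> Sigma_i \<Longrightarrow> 0 < c \<Longrightarrow> (\<lambda>x. c / f x) \<in> Sigma_d"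
  by (auto simp: Sigma_i_def Sigma_d_def monotone_on_def less_imp_le less_imp_neq[symmetric]
      intro!: continuous_intros divide_left_mono)

section \<open>Spectral decomposition of the first-order system\<close>

text \<open>Sums over the nonzero integers are computed by grouping \<open>k\<close> with \<open>- k\<close>, which is legitimate
  because the terms are nonnegative.\<close>

lemma has_sum_nonzero_ints:
  fixes f :: "int \<Rightarrow> real"
  assumes nonneg: "\<And>k. 0 \<le> f k"
    and sums: "(\<lambda>n. f (int (Suc n)) + f (- int (Suc n))) sums s"
  shows "(f has_sum s) (UNIV - {0})"
proof -
  have half: "(f has_sum (\<Sum>n. f (g n))) (range g)"
    if inj: "inj g" and le: "\<And>n. f (g n) \<le> f (int (Suc n)) + f (- int (Suc n))" for g
  proof -
    have "summable (\<lambda>n. f (g n))"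
      using sums_summable[OF sums]
      by (rule summable_comparison_test'[of _ 0]) (simp add: nonneg le del: of_nat_Suc)
    then have "((\<lambda>n. f (g n)) has_sum (\<Sum>n. f (g n))) UNIV"
      by (intro sums_nonneg_imp_has_sum summable_sums nonneg)
    then show ?thesis
      using has_sum_reindex[OF inj, of f] by (simp add: o_def)
  qed
  let ?p = "\<lambda>n. int (Suc n)" and ?m = "\<lambda>n. - int (Suc n)"
  have p: "(f has_sum (\<Sum>n. f (?p n))) (range ?p)" and m: "(f has_sum (\<Sum>n. f (?m n))) (range ?m)"
    by (rule half; simp add: inj_def nonneg del: of_nat_Suc; simp)+
  have sm: "summable (\<lambda>n. f (?p n))" "summable (\<lambda>n. f (?m n))"
    by (rule summable_comparison_test'[OF sums_summable[OF sums], of 0]; simp add: nonneg del: of_nat_Suc)+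
  have "range ?p \<union> range ?m = UNIV - {0}"
  proof -
    have "k \<in> range ?p \<union> range ?m" if "k \<noteq> 0" for k
    proof (cases "k > 0")
      case True
      then have "k = ?p (nat k - 1)" by simp
      then show ?thesis by blast
    next
      case False
      then have "k = ?m (nat (- k) - 1)" using that by simp
      then show ?thesis by blast
    qed
    then show ?thesis by auto
  qed
  moreover have "range ?p \<inter> range ?m = {}"
    by auto
  moreover have "(\<Sum>n. f (?p n)) + (\<Sum>n. f (?m n)) = s"
    using suminf_add[OF sm] sums_unique[OF sums] by simp
  ultimately show ?thesis
    using has_sum_Un_disjoint[OF p m] by simp
qed

lemma cmod_parallelogram: "(cmod (\<i> * a + b))\<^sup>2 + (cmod (- (\<i> * a) + b))\<^sup>2 = 2 * ((cmod a)\<^sup>2 + (cmod b)\<^sup>2)"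
  unfolding cmod_power2 by (simp add: power2_eq_square algebra_simps)

locale wave_operator =
  fixes A0 S :: "('h::complex_hilbert, 'h) unbdd_op"
    and lam :: "nat \<Rightarrow> real" and \<phi> :: "nat \<Rightarrow> 'h"
  assumes A0_self_adjoint: "self_adjoint A0"
    and S_sqrt: "is_sqrt_op S A0"
    and eigenbasis: "eigenbasis S lam \<phi>"
begin

abbreviation "A \<equiv> op_app (A_op A0 S)"
abbreviation "dom_A \<equiv> op_dom (A_op A0 S)"
abbreviation "X \<equiv> X_space S"
abbreviation "N \<equiv> X_norm S"
abbreviation "mode_coeff z k \<equiv> X_inner S z (eigvec_A lam \<phi> k)"

lemma S_self_adjoint: "self_adjoint S"
  using S_sqrt by (simp add: is_sqrt_op_def)

lemmas S_symmetric = self_adjoint_symmetric[OF S_self_adjoint]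
  and S_simps [simp] = clinear_on_simps[OF self_adjoint_clinear[OF S_self_adjoint]]
  and A0_simps [simp] = clinear_on_simps[OF self_adjoint_clinear[OF A0_self_adjoint]]

lemma dom_A0_iff: "u \<in> op_dom A0 \<longleftrightarrow> u \<in> op_dom S \<and> op_app S u \<in> op_dom S"
  using S_sqrt by (auto simp: is_sqrt_op_def)

lemma A0_eq: "u \<in> op_dom A0 \<Longrightarrow> op_app A0 u = op_app S (op_app S u)"
  using S_sqrt by (simp add: is_sqrt_op_def)

lemma S_nonneg: "u \<in> op_dom S \<Longrightarrow> 0 \<le> Re (cinner (op_app S u) u)"
  using S_sqrt cinner_scaleR_left[of 0 0 u]
  by (cases "u = 0") (auto simp: is_sqrt_op_def positive_op_def less_imp_le)

lemma dom_A_iff: "z \<in> dom_A \<longleftrightarrow> fst z \<in> op_dom A0 \<and> snd z \<in> op_dom S"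
  by (simp add: A_op_def mem_Times_iff)

lemma A_eq: "A z = (- (\<i> *\<^sub>C snd z), \<i> *\<^sub>C op_app A0 (fst z))"
  by (simp add: A_op_def)

lemma X_iff: "z \<in> X \<longleftrightarrow> fst z \<in> op_dom S"
  by (simp add: X_space_def mem_Times_iff)

lemma dom_A_subset_X: "z \<in> dom_A \<Longrightarrow> z \<in> X"
  by (simp add: dom_A_iff X_iff dom_A0_iff)

lemma A_in_X: "z \<in> dom_A \<Longrightarrow> A z \<in> X"
  by (simp add: dom_A_iff X_iff A_eq)

lemma basis: "orthonormal_basis \<phi>"
  using eigenbasis by (simp add: eigenbasis_def)

lemma basis_inner: "j \<ge> 1 \<Longrightarrow> k \<ge> 1 \<Longrightarrow> cinner (\<phi> j) (\<phi> k) = (if j = k then 1 else 0)"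
  using basis by (simp add: orthonormal_basis_def)

lemma basis_dom: "k \<ge> 1 \<Longrightarrow> \<phi> k \<in> op_dom S" and S_basis: "k \<ge> 1 \<Longrightarrow> op_app S (\<phi> k) = lam k *\<^sub>R \<phi> k"
  using eigenbasis by (auto simp: eigenbasis_def)

lemma lam_mono: "1 \<le> j \<Longrightarrow> j \<le> k \<Longrightarrow> lam j \<le> lam k"
  using eigenbasis by (auto simp: eigenbasis_def monotone_on_def)

lemma lam_pos: assumes "k \<ge> 1" shows "0 < lam k"
proof -
  have "\<phi> k \<noteq> 0"
    using basis_inner[OF assms assms] cinner_scaleR_left[of 0 0 "\<phi> k"] by auto
  then have "0 < Re (cinner (op_app S (\<phi> k)) (\<phi> k))"
    using S_sqrt basis_dom[OF assms] by (auto simp: is_sqrt_op_def positive_op_def)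
  then show ?thesis
    using S_basis[OF assms] basis_inner[OF assms assms] by (simp add: cinner_scaleR_left)
qed

lemma S_coeff: "u \<in> op_dom S \<Longrightarrow> k \<ge> 1 \<Longrightarrow> cinner (op_app S u) (\<phi> k) = lam k * cinner u (\<phi> k)"
  by (simp add: S_symmetric basis_dom S_basis cinner_scaleR_right scaleR_conv_of_real)

lemma norm_sums: "(\<lambda>k. (cmod (cinner x (\<phi> (Suc k))))\<^sup>2) sums (norm x)\<^sup>2"
proof -
  have "cinner x (\<phi> k) * cinner (\<phi> k) x = complex_of_real ((cmod (cinner x (\<phi> k)))\<^sup>2)" for k
    by (metis cinner_commute complex_norm_square)
  then show ?thesis
    using sums_Re[OF Parseval_sums[OF basis, of x x]] by (simp add: Re_cinner_self del: of_real_power)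
qed

lemma S_form_sums:
  assumes "u \<in> op_dom S"
  shows "(\<lambda>k. lam (Suc k) * (cmod (cinner u (\<phi> (Suc k))))\<^sup>2) sums Re (cinner (op_app S u) u)"
proof -
  have "cinner (op_app S u) (\<phi> (Suc k)) * cinner (\<phi> (Suc k)) u
      = complex_of_real (lam (Suc k) * (cmod (cinner u (\<phi> (Suc k))))\<^sup>2)" for k
    unfolding S_coeff[OF assms, of "Suc k", simplified]
    by (metis cinner_commute complex_norm_square mult.assoc of_real_mult)
  then show ?thesis
    using sums_Re[OF Parseval_sums[OF basis, of "op_app S u" u]]
    by (simp del: of_real_power of_real_mult)
qed

text \<open>By monotonicity \<open>lam 1\<close> is the smallest eigenvalue, so the bound holds in each mode.\<close>

lemma S_coercive:
  assumes "u \<in> op_dom S"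
  shows "norm u \<le> norm (op_app S u) / lam 1"
proof -
  have "(lam 1)\<^sup>2 * (cmod (cinner u (\<phi> (Suc k))))\<^sup>2 \<le> (cmod (cinner (op_app S u) (\<phi> (Suc k))))\<^sup>2" for k
  proof -
    have "(lam 1)\<^sup>2 \<le> (lam (Suc k))\<^sup>2"
      using lam_mono[of 1 "Suc k"] lam_pos[of 1] by (intro power_mono) auto
    then show ?thesis
      using assms by (simp add: S_coeff norm_mult power_mult_distrib mult_right_mono)
  qed
  then have "(lam 1)\<^sup>2 * (norm u)\<^sup>2 \<le> (norm (op_app S u))\<^sup>2"
    by (rule sums_le[OF _ sums_mult[OF norm_sums] norm_sums])
  then have "(lam 1 * norm u)\<^sup>2 \<le> (norm (op_app S u))\<^sup>2"
    by (simp add: power_mult_distrib)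
  then have "lam 1 * norm u \<le> norm (op_app S u)"
    by (rule power2_le_imp_le) simp
  then show ?thesis
    using lam_pos[of 1] by (simp add: field_simps)
qed

lemma N_power2: "(N z)\<^sup>2 = (norm (op_app S (fst z)))\<^sup>2 + (norm (snd z))\<^sup>2"
  by (simp add: X_norm_def)

lemma N_eq_norm: "N z = norm (op_app S (fst z), snd z)"
  by (simp add: X_norm_def norm_prod_def)

lemma N_nonneg: "0 \<le> N z"
  by (simp add: X_norm_def)

lemma X_closed:
  "z \<in> X \<Longrightarrow> w \<in> X \<Longrightarrow> z + w \<in> X" "z \<in> X \<Longrightarrow> w \<in> X \<Longrightarrow> z - w \<in> X"
  "z \<in> X \<Longrightarrow> c *\<^sub>C z \<in> X" "z \<in> X \<Longrightarrow> r *\<^sub>R z \<in> X"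
  by (simp_all add: X_iff scaleC_prod_def)

lemma N_triangle: "z \<in> X \<Longrightarrow> w \<in> X \<Longrightarrow> N (z - w) \<le> N z + N w"
  using norm_triangle_ineq4[of "(op_app S (fst z), snd z)" "(op_app S (fst w), snd w)"]
  by (simp add: N_eq_norm X_iff)

lemma N_scaleC: "z \<in> X \<Longrightarrow> N (c *\<^sub>C z) = cmod c * N z"
  using norm_scaleC_prod[of c "(op_app S (fst z), snd z)"]
  by (simp add: N_eq_norm X_iff scaleC_prod_def)

lemma N_scaleR: "z \<in> X \<Longrightarrow> N (r *\<^sub>R z) = \<bar>r\<bar> * N z"
  by (simp add: scaleR_scaleC[of r z] N_scaleC)

lemma norm_S_fst_le: "norm (op_app S (fst z)) \<le> N z" and norm_snd_le: "norm (snd z) \<le> N z"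
  by (simp_all add: X_norm_def)

lemma norm_fst_le: "z \<in> X \<Longrightarrow> norm (fst z) \<le> N z / lam 1"
  using S_coercive[of "fst z"] norm_S_fst_le[of z] lam_pos[of 1]
  by (simp add: X_iff) (meson divide_right_mono less_imp_le order_trans)

lemma norm_le_N: "z \<in> X \<Longrightarrow> norm z \<le> (1 / lam 1 + 1) * N z"
  using norm_Pair_le[of "fst z" "snd z"] norm_fst_le[of z] norm_snd_le[of z]
  by (simp add: algebra_simps)

lemma N_pos: assumes "z \<in> X" "z \<noteq> 0" shows "0 < N z"
proof -
  have "N z \<noteq> 0"
    using norm_le_N[OF assms(1)] assms(2) by auto
  then show ?thesis using N_nonneg[of z] by simp
qed

lemma N_add_square:
  assumes "z \<in> X" "w \<in> X"
  shows "(N (z + w))\<^sup>2 = (N z)\<^sup>2 + (N w)\<^sup>2 + 2 * Re (X_inner S z w)"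
  using assms by (simp add: N_power2 X_inner_def X_iff norm_add_square)

lemma mode_coeff_eq:
  assumes "z \<in> X" "k \<noteq> 0"
  shows "mode_coeff z k = (\<i> * sgn (of_int k) * cinner (op_app S (fst z)) (\<phi> (nat \<bar>k\<bar>)) + cinner (snd z) (\<phi> (nat \<bar>k\<bar>))) / sqrt 2"
proof -
  define j where "j = nat \<bar>k\<bar>"
  have j: "j \<ge> 1" using assms(2) by (simp add: j_def)
  have l: "lam j \<noteq> 0" using lam_pos[OF j] by simp
  have sg: "sgn (real_of_int k) = 1 \<or> sgn (real_of_int k) = -1"
    using assms(2) by (auto simp: sgn_if)
  have sgc: "sgn (of_int k) = complex_of_real (sgn (real_of_int k))"
    by (metis of_real_of_int_eq sgn_of_real)
  show ?thesis
    unfolding eigvec_A_def X_inner_def eigval_A_def j_def[symmetric] sgc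
    using sg l by (auto simp: basis_dom[OF j] S_basis[OF j] cinner_scaleR_right cinner_scaleC_right
        scaleR_conv_of_real field_simps)
qed

text \<open>The frequencies \<open>k\<close> and \<open>-k\<close> together carry the mass of the \<open>k\<close>-th mode of both
  components.\<close>

lemma mode_coeff_pair:
  assumes "z \<in> X"
  shows "(cmod (mode_coeff z (int (Suc n))))\<^sup>2 + (cmod (mode_coeff z (- int (Suc n))))\<^sup>2
    = (cmod (cinner (op_app S (fst z)) (\<phi> (Suc n))))\<^sup>2 + (cmod (cinner (snd z) (\<phi> (Suc n))))\<^sup>2"
proof -
  have "nat \<bar>int (Suc n)\<bar> = Suc n" "nat \<bar>- int (Suc n)\<bar> = Suc n"
    by simp_all
  moreover have "sgn (of_int (int (Suc n))) = (1::complex)" "sgn (of_int (- int (Suc n))) = (-1::complex)"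
    by (simp_all add: sgn_eq del: of_nat_Suc)
  ultimately show ?thesis
    using cmod_parallelogram[of "cinner (op_app S (fst z)) (\<phi> (Suc n))" "cinner (snd z) (\<phi> (Suc n))"]
    by (simp add: mode_coeff_eq[OF assms] norm_divide power_divide del: of_nat_Suc)
qed

lemma mode_coeff_has_sum:
  assumes "z \<in> X"
  shows "((\<lambda>k. (cmod (mode_coeff z k))\<^sup>2) has_sum (N z)\<^sup>2) (UNIV - {0})"
proof (rule has_sum_nonzero_ints)
  show "(\<lambda>n. (cmod (mode_coeff z (int (Suc n))))\<^sup>2 + (cmod (mode_coeff z (- int (Suc n))))\<^sup>2) sums (N z)\<^sup>2"
    unfolding mode_coeff_pair[OF assms] N_power2 by (intro sums_add norm_sums)
qed simp

text \<open>The form \<open>\<langle>|A| z, z\<rangle>\<close> of the energy space: \<open>|A|\<close> acts as \<open>A\<^sub>0\<^sup>1\<^sup>/\<^sup>2\<close> on both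
  components, and the energy inner product applies one more \<open>A\<^sub>0\<^sup>1\<^sup>/\<^sup>2\<close> to the first.\<close>

definition quadratic_form :: "'h \<times> 'h \<Rightarrow> real" where
  "quadratic_form z = Re (cinner (op_app S (op_app S (fst z))) (op_app S (fst z)))
    + Re (cinner (op_app S (snd z)) (snd z))"

lemma weighted_mode_coeff_has_sum:
  assumes "z \<in> dom_A"
  shows "((\<lambda>k. lam (nat \<bar>k\<bar>) * (cmod (mode_coeff z k))\<^sup>2) has_sum quadratic_form z) (UNIV - {0})"
proof -
  \<comment> \<open>The sign of \<open>lam 0\<close> is unknown, so the term at \<open>0\<close> is replaced by \<open>0\<close>.\<close>
  let ?f = "\<lambda>k. if k = 0 then 0 else lam (nat \<bar>k\<bar>) * (cmod (mode_coeff z k))\<^sup>2"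
  have "(?f has_sum quadratic_form z) (UNIV - {0})"
  proof (rule has_sum_nonzero_ints)
    show "0 \<le> ?f k" for k
      using lam_pos[of "nat \<bar>k\<bar>"] by (cases "k = 0") (simp_all add: Suc_le_eq)
    have "?f (int (Suc n)) + ?f (- int (Suc n))
      = lam (Suc n) * (cmod (cinner (op_app S (fst z)) (\<phi> (Suc n))))\<^sup>2
        + lam (Suc n) * (cmod (cinner (snd z) (\<phi> (Suc n))))\<^sup>2" for n
    proof -
      have "nat \<bar>int (Suc n)\<bar> = Suc n" "nat \<bar>- int (Suc n)\<bar> = Suc n"
        "int (Suc n) \<noteq> 0" "- int (Suc n) \<noteq> 0"
        by simp_all
      then show ?thesis
        using mode_coeff_pair[OF dom_A_subset_X[OF assms], of n]
        by (simp del: of_nat_Suc flip: distrib_left)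
    qed
    then show "(\<lambda>n. ?f (int (Suc n)) + ?f (- int (Suc n))) sums quadratic_form z"
      unfolding quadratic_form_def using assms
      by (simp only:) (intro sums_add S_form_sums; simp add: dom_A_iff dom_A0_iff)
  qed
  then show ?thesis
    by (rule has_sum_cong[THEN iffD1, rotated]) simp
qed

lemma freq_absA_eq: "z \<in> dom_A \<Longrightarrow> freq_absA S lam \<phi> z = quadratic_form z / (N z)\<^sup>2"
  unfolding freq_absA_def
  using infsumI[OF weighted_mode_coeff_has_sum] infsumI[OF mode_coeff_has_sum[OF dom_A_subset_X]] by simp

text \<open>With \<open>a = A\<^sub>0\<^sup>1\<^sup>/\<^sup>2 u\<close> the form of \<open>A\<close> is \<open>- 2 Im \<langle>a, A\<^sub>0\<^sup>1\<^sup>/\<^sup>2 v\<rangle>\<close>, up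
  to sign the cross term in the nonnegative form of \<open>A\<^sub>0\<^sup>1\<^sup>/\<^sup>2\<close> at \<open>a \<plusminus> i v\<close>.\<close>

lemma abs_freq_A_le:
  assumes z: "z \<in> dom_A"
  shows "\<bar>freq_A A0 S z\<bar> \<le> freq_absA S lam \<phi> z"
proof -
  define a v where "a = op_app S (fst z)" and "v = snd z"
  have dom: "fst z \<in> op_dom A0" "a \<in> op_dom S" "v \<in> op_dom S"
    using z by (auto simp: a_def v_def dom_A_iff dom_A0_iff)
  define c where "c = cinner a (op_app S v)"
  have c1: "cinner (op_app S v) a = cnj c" and c2: "cinner (op_app S a) v = c"
    unfolding c_def using dom by (metis cinner_commute, simp add: S_symmetric)
  have form: "Re (X_inner S (A z) z) = - 2 * Im c"
    using dom by (simp add: X_inner_def A_eq A0_eq a_def[symmetric] v_def[symmetric]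
        cinner_minus_left cinner_scaleC_left c1 c2)
  have "0 \<le> Re (cinner (op_app S (a + (\<i> * of_real \<sigma>) *\<^sub>C v)) (a + (\<i> * of_real \<sigma>) *\<^sub>C v))" for \<sigma>
    using dom by (intro S_nonneg) simp
  then have pos: "0 \<le> Re (cinner (op_app S a) a) + \<sigma>\<^sup>2 * Re (cinner (op_app S v) v) + 2 * \<sigma> * Im c" for \<sigma>
    using dom by (simp add: cinner_add_left cinner_add_right cinner_scaleC_left cinner_scaleC_right
        c1 c2 power2_eq_square algebra_simps)
  have "\<bar>Re (X_inner S (A z) z)\<bar> \<le> quadratic_form z"
    using pos[of 1] pos[of "-1"] form by (simp add: quadratic_form_def a_def v_def)
  then show ?thesis
    by (simp add: freq_A_def freq_absA_eq[OF z] divide_right_mono)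
qed

text \<open>The Rayleigh quotient \<open>\<lambda>\<close> of \<open>z\<close> makes \<open>A z - \<lambda> z\<close> orthogonal to \<open>z\<close>, whence a
  Pythagorean identity.\<close>

lemma shifted_norm_square:
  assumes z: "z \<in> dom_A" "z \<noteq> 0"
  shows "(N (A z - \<mu> *\<^sub>R z))\<^sup>2
    = (N (A z - freq_A A0 S z *\<^sub>R z))\<^sup>2 + (\<mu> - freq_A A0 S z)\<^sup>2 * (N z)\<^sup>2"
proof -
  define \<mu>0 where "\<mu>0 = freq_A A0 S z"
  have X: "z \<in> X" "A z - \<mu>0 *\<^sub>R z \<in> X" "(\<mu>0 - \<mu>) *\<^sub>R z \<in> X"
    using dom_A_subset_X[OF z(1)] A_in_X[OF z(1)] by (simp_all add: X_closed)
  have "Re (X_inner S (A z) z) = \<mu>0 * (N z)\<^sup>2"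
    using N_pos[OF X(1) z(2)] by (simp add: \<mu>0_def freq_A_def)
  moreover have "Re (X_inner S (A z - \<mu>0 *\<^sub>R z) z) = Re (X_inner S (A z) z) - \<mu>0 * (N z)\<^sup>2"
    using z(1) by (simp add: X_inner_def dom_A_iff dom_A0_iff A_eq cinner_diff_left cinner_scaleR_left
        Re_cinner_self N_power2 algebra_simps)
  moreover have "Re (X_inner S w ((\<mu>0 - \<mu>) *\<^sub>R z)) = (\<mu>0 - \<mu>) * Re (X_inner S w z)" for w
    using X(1) by (simp add: X_inner_def X_iff cinner_scaleR_right distrib_left)
  ultimately have "Re (X_inner S (A z - \<mu>0 *\<^sub>R z) ((\<mu>0 - \<mu>) *\<^sub>R z)) = 0"
    by simp
  then have "(N ((A z - \<mu>0 *\<^sub>R z) + (\<mu>0 - \<mu>) *\<^sub>R z))\<^sup>2 = (N (A z - \<mu>0 *\<^sub>R z))\<^sup>2 + (\<mu> - \<mu>0)\<^sup>2 * (N z)\<^sup>2"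
    using N_add_square[OF X(2,3)] N_scaleR[OF X(1), of "\<mu>0 - \<mu>"]
    by (simp add: power_mult_distrib power2_commute)
  then show ?thesis
    by (simp add: \<mu>0_def[symmetric] algebra_simps)
qed

end

section \<open>Resolvent estimates\<close>

lemma power2_add_le: "(x + y)\<^sup>2 \<le> 2 * x\<^sup>2 + 2 * y\<^sup>2" for x y :: real
  using zero_le_power2[of "x - y"] by (simp add: power2_eq_square algebra_simps)

context wave_operator
begin

text \<open>Let \<open>(f, g) = (A - \<mu>) (u, v)\<close>. Then \<open>v = i f + i \<mu> u\<close> and \<open>(A\<^sub>0 - \<mu>\<^sup>2) u = \<mu> f - i g\<close>. So
  \<open>u\<close> almost solves the stationary second-order equation, up to an error controlled by the energy
  norm of \<open>(f, g)\<close>, and the second-order inequality for \<open>u\<close> also controls \<open>v\<close>. Coercivity turns the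
  bound of \<open>f\<close> in the energy norm into one in \<open>H\<close>, which is where the factors \<open>1 / (lam 1)\<^sup>2\<close>
  come from.\<close>

lemma first_order_resolvent_estimate:
  assumes pos: "0 < p" "0 < e"
    and ineq: "\<And>u. u \<in> op_dom A0 - {0} \<Longrightarrow> \<mu>\<^sup>2 * (norm u)\<^sup>2 + (norm (op_app S u))\<^sup>2
      \<le> max ((norm (C0 u))\<^sup>2 / p) ((norm (op_app A0 u - \<mu>\<^sup>2 *\<^sub>R u))\<^sup>2 / e)"
    and z: "z \<in> dom_A"
  shows "(N z)\<^sup>2 \<le> 2 / p * (norm (C0 (fst z)))\<^sup>2
    + (4 * (1 + \<mu>\<^sup>2 / (lam 1)\<^sup>2) / e + 2 / (lam 1)\<^sup>2) * (N (A z - \<mu> *\<^sub>R z))\<^sup>2"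
proof -
  define u v where "u = fst z" and "v = snd z"
  have u: "u \<in> op_dom A0" using z by (simp add: u_def dom_A_iff)
  define F where "F = A z - \<mu> *\<^sub>R z"
  define f g where "f = - (\<i> *\<^sub>C v) - \<mu> *\<^sub>R u" and "g = \<i> *\<^sub>C op_app A0 u - \<mu> *\<^sub>R v"
  have F: "F \<in> X" "fst F = f" "snd F = g"
    using dom_A_subset_X[OF z] A_in_X[OF z] by (simp_all add: F_def X_closed f_def g_def A_eq u_def v_def)
  have nf: "norm f \<le> N F / lam 1" and ng: "norm g \<le> N F"
    using norm_fst_le[OF F(1)] norm_snd_le[of F] by (simp_all add: F)
  have nf2: "(norm f)\<^sup>2 \<le> (N F)\<^sup>2 / (lam 1)\<^sup>2" and ng2: "(norm g)\<^sup>2 \<le> (N F)\<^sup>2"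
    using power_mono[OF nf, of 2] power_mono[OF ng, of 2] by (simp_all add: power_divide)
  have "v = \<i> *\<^sub>C f + \<i> *\<^sub>C (\<mu> *\<^sub>R u)"
    by (simp add: f_def complex_vs.scale_right_diff_distrib scaleC_scaleC)
  then have "norm v \<le> norm f + \<bar>\<mu>\<bar> * norm u"
    by (metis norm_triangle_ineq norm_scaleC norm_ii mult_1 norm_scaleR)
  then have "(norm v)\<^sup>2 \<le> (norm f + \<bar>\<mu>\<bar> * norm u)\<^sup>2"
    by (rule power_mono) simp
  also have "\<dots> \<le> 2 * (norm f)\<^sup>2 + 2 * (\<mu>\<^sup>2 * (norm u)\<^sup>2)"
    using power2_add_le[of "norm f" "\<bar>\<mu>\<bar> * norm u"] by (simp add: power_mult_distrib)
  finally have nv: "(norm v)\<^sup>2 \<le> 2 * (norm f)\<^sup>2 + 2 * (\<mu>\<^sup>2 * (norm u)\<^sup>2)" .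
  have "op_app A0 u - \<mu>\<^sup>2 *\<^sub>R u = \<mu> *\<^sub>R f - \<i> *\<^sub>C g"
    by (simp add: f_def g_def complex_vs.scale_right_diff_distrib scaleC_scaleC scaleC_scaleR_commute
        power2_eq_square scaleR_diff_right)
  then have "norm (op_app A0 u - \<mu>\<^sup>2 *\<^sub>R u) \<le> \<bar>\<mu>\<bar> * norm f + norm g"
    by (metis norm_triangle_ineq4 norm_scaleC norm_ii mult_1 norm_scaleR)
  then have "(norm (op_app A0 u - \<mu>\<^sup>2 *\<^sub>R u))\<^sup>2 \<le> (\<bar>\<mu>\<bar> * norm f + norm g)\<^sup>2"
    by (rule power_mono) simp
  also have "\<dots> \<le> 2 * (\<mu>\<^sup>2 * (norm f)\<^sup>2) + 2 * (norm g)\<^sup>2"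
    using power2_add_le[of "\<bar>\<mu>\<bar> * norm f" "norm g"] by (simp add: power_mult_distrib)
  also have "\<dots> \<le> 2 * (\<mu>\<^sup>2 * ((N F)\<^sup>2 / (lam 1)\<^sup>2)) + 2 * (N F)\<^sup>2"
    using nf2 ng2 by (intro add_mono mult_left_mono) auto
  also have "\<dots> = 2 * (1 + \<mu>\<^sup>2 / (lam 1)\<^sup>2) * (N F)\<^sup>2"
    by (simp add: algebra_simps)
  finally have r: "(norm (op_app A0 u - \<mu>\<^sup>2 *\<^sub>R u))\<^sup>2 / e \<le> 2 * (1 + \<mu>\<^sup>2 / (lam 1)\<^sup>2) * (N F)\<^sup>2 / e"
    using pos by (intro divide_right_mono) auto
  have "\<mu>\<^sup>2 * (norm u)\<^sup>2 + (norm (op_app S u))\<^sup>2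
      \<le> (norm (C0 u))\<^sup>2 / p + (norm (op_app A0 u - \<mu>\<^sup>2 *\<^sub>R u))\<^sup>2 / e"
  proof (cases "u = 0")
    case True
    then show ?thesis using pos by simp
  next
    case False
    have "0 \<le> (norm (C0 u))\<^sup>2 / p" "0 \<le> (norm (op_app A0 u - \<mu>\<^sup>2 *\<^sub>R u))\<^sup>2 / e"
      using pos by simp_all
    then have le: "max ((norm (C0 u))\<^sup>2 / p) ((norm (op_app A0 u - \<mu>\<^sup>2 *\<^sub>R u))\<^sup>2 / e)
        \<le> (norm (C0 u))\<^sup>2 / p + (norm (op_app A0 u - \<mu>\<^sup>2 *\<^sub>R u))\<^sup>2 / e"
      by simp
    show ?thesis
      by (rule order_trans[OF ineq le]) (use u False in simp)
  qed
  with r have main: "\<mu>\<^sup>2 * (norm u)\<^sup>2 + (norm (op_app S u))\<^sup>2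
      \<le> (norm (C0 u))\<^sup>2 / p + 2 * (1 + \<mu>\<^sup>2 / (lam 1)\<^sup>2) * (N F)\<^sup>2 / e"
    by linarith
  have "(N z)\<^sup>2 \<le> 2 * (\<mu>\<^sup>2 * (norm u)\<^sup>2 + (norm (op_app S u))\<^sup>2) + 2 * (norm f)\<^sup>2"
    unfolding N_power2 u_def[symmetric] v_def[symmetric] distrib_left
    using nv zero_le_power2[of "norm (op_app S u)"] by linarith
  also have "\<dots> \<le> 2 * ((norm (C0 u))\<^sup>2 / p + 2 * (1 + \<mu>\<^sup>2 / (lam 1)\<^sup>2) * (N F)\<^sup>2 / e) + 2 * ((N F)\<^sup>2 / (lam 1)\<^sup>2)"
    by (intro add_mono mult_left_mono main nf2) auto
  also have "\<dots> = 2 / p * (norm (C0 u))\<^sup>2 + (4 * (1 + \<mu>\<^sup>2 / (lam 1)\<^sup>2) / e + 2 / (lam 1)\<^sup>2) * (N F)\<^sup>2"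
    using pos lam_pos[of 1] by (simp add: distrib_right)
  finally show ?thesis
    by (simp add: u_def F_def)
qed

text \<open>By the Pythagorean identity, the claim for any \<open>\<mu>\<close> follows from the one for the Rayleigh
  quotient \<open>\<mu>\<^sub>0\<close> of \<open>z\<close>. At \<open>\<mu>\<^sub>0\<close> the estimate has constants controlled by \<open>\<Lambda>\<close>, since
  \<open>|\<mu>\<^sub>0| \<le> \<Lambda>\<close>. One of its two terms is at least half of \<open>\<parallel>z\<parallel>\<^sup>2\<close>, which explains the factors
  \<open>2\<close>.\<close>

lemma frequency_resolvent_inequality:
  assumes a: "a \<in> Sigma_i" and b: "b \<in> Sigma_i"
    and est: "\<And>\<mu> z. z \<in> dom_A \<Longrightarrow>
      (N z)\<^sup>2 \<le> a \<mu> * (norm (C0 (fst z)))\<^sup>2 + b \<mu> * (N (A z - \<mu> *\<^sub>R z))\<^sup>2"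
    and z: "z \<in> dom_A - {0}"
  defines "\<Lambda> \<equiv> freq_absA S lam \<phi> z"
  shows "(N z)\<^sup>2 \<le> max ((norm (C_op C0 z))\<^sup>2 / (1 / (2 * a \<Lambda>)))
    ((N (A z - \<mu> *\<^sub>R z))\<^sup>2 / ((\<mu> - freq_A A0 S z)\<^sup>2 + 1 / (2 * b \<Lambda>)))"
proof -
  let ?\<mu>0 = "freq_A A0 S z"
  let ?F0 = "(N (A z - ?\<mu>0 *\<^sub>R z))\<^sup>2"
  have zz: "z \<in> dom_A" "z \<noteq> 0" using z by auto
  have ap: "0 < a \<Lambda>" and bp: "0 < b \<Lambda>" using a b by (auto intro: Sigma_i_pos)
  have le: "\<bar>?\<mu>0\<bar> \<le> \<bar>\<Lambda>\<bar>"
    using abs_freq_A_le[OF zz(1)] by (simp add: \<Lambda>_def)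
  have "(N z)\<^sup>2 \<le> a ?\<mu>0 * (norm (C0 (fst z)))\<^sup>2 + b ?\<mu>0 * ?F0"
    by (rule est[OF zz(1)])
  also have "\<dots> \<le> a \<Lambda> * (norm (C0 (fst z)))\<^sup>2 + b \<Lambda> * ?F0"
    by (intro add_mono mult_right_mono Sigma_i_le[OF a] Sigma_i_le[OF b] le) auto
  finally consider "(N z)\<^sup>2 \<le> 2 * a \<Lambda> * (norm (C0 (fst z)))\<^sup>2" | "(N z)\<^sup>2 \<le> 2 * b \<Lambda> * ?F0"
    by linarith
  then show ?thesis
  proof cases
    case 1
    then show ?thesis by (simp add: C_op_def mult.commute le_max_iff_disj)
  next
    case 2
    then have "(N z)\<^sup>2 / (2 * b \<Lambda>) \<le> ?F0"
      using bp by (simp add: field_simps)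
    then have "(N z)\<^sup>2 * ((\<mu> - ?\<mu>0)\<^sup>2 + 1 / (2 * b \<Lambda>)) \<le> (N (A z - \<mu> *\<^sub>R z))\<^sup>2"
      using shifted_norm_square[OF zz, of \<mu>] by (simp add: distrib_left mult.commute)
    moreover have "0 < (\<mu> - ?\<mu>0)\<^sup>2 + 1 / (2 * b \<Lambda>)"
      using bp by (intro add_nonneg_pos) auto
    ultimately show ?thesis
      by (simp add: pos_le_divide_eq le_max_iff_disj)
  qed
qed

section \<open>Concentration on a low eigenmode\<close>

text \<open>The resolvent maps suitable multiples of the eigenvectors, bounded as long as the eigenvalues are,
  back to the eigenvectors. These have mutual distance \<open>sqrt 2\<close>, so infinitely many of them do not fit
  into a compact set.\<close>

lemma finite_low_eigenvalues:
  assumes "compact_resolvent A0"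
  shows "finite {k. k \<ge> 1 \<and> lam k \<le> t}"
proof (rule ccontr)
  let ?I = "{k. k \<ge> 1 \<and> lam k \<le> t}"
  assume inf: "infinite ?I"
  obtain \<zeta> R where R: "is_resolvent A0 \<zeta> R" and cpt: "compact_map R"
    using assms by (auto simp: compact_resolvent_def)
  let ?c = "\<lambda>k. complex_of_real ((lam k)\<^sup>2) - \<zeta>"
  define Q where "Q = (\<lambda>k. ?c k *\<^sub>C \<phi> k) ` ?I"
  have n1: "norm (\<phi> k) = 1" if "k \<ge> 1" for k
  proof -
    have "(norm (\<phi> k))\<^sup>2 = 1"
      using basis_inner[OF that that] Re_cinner_self[of "\<phi> k"] by simp
    then show ?thesis using power2_eq_imp_eq[of "norm (\<phi> k)" 1] by simp
  qed
  have R\<phi>: "R (?c k *\<^sub>C \<phi> k) = \<phi> k" if "k \<ge> 1" for k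
  proof -
    have d: "\<phi> k \<in> op_dom A0"
      using that by (simp add: dom_A0_iff basis_dom S_basis)
    have "op_app A0 (\<phi> k) - \<zeta> *\<^sub>C \<phi> k = ?c k *\<^sub>C \<phi> k"
      using that by (simp add: A0_eq[OF d] S_basis basis_dom complex_vs.scale_left_diff_distrib
          scaleR_scaleC[where 'a = 'h] scaleC_scaleC power2_eq_square)
    then show ?thesis
      using R d by (metis is_resolvent_def)
  qed
  have "norm (?c k *\<^sub>C \<phi> k) \<le> t\<^sup>2 + cmod \<zeta>" if "k \<in> ?I" for k
  proof -
    have "(lam k)\<^sup>2 \<le> t\<^sup>2"
      using that lam_pos[of k] by (intro power_mono) auto
    then show ?thesis
      using that norm_triangle_ineq4[of "complex_of_real ((lam k)\<^sup>2)" \<zeta>]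
      by (simp add: norm_scaleC n1 norm_power)
  qed
  then have "bounded Q"
    unfolding Q_def bounded_iff by auto
  then have K: "compact (closure (R ` Q))"
    using cpt by (simp add: compact_map_def)
  have "\<phi> ` ?I \<subseteq> R ` Q"
  proof
    fix y assume "y \<in> \<phi> ` ?I"
    then obtain k where k: "k \<in> ?I" "y = R (?c k *\<^sub>C \<phi> k)"
      using R\<phi> by auto
    then show "y \<in> R ` Q" by (auto simp: Q_def)
  qed
  then have sub: "\<phi> ` ?I \<subseteq> closure (R ` Q)"
    using closure_subset by blast
  have sep: "1 < dist (\<phi> j) (\<phi> k)" if "j \<ge> 1" "k \<ge> 1" "j \<noteq> k" for j k
  proof -
    have "(norm (\<phi> j + (- 1) *\<^sub>R \<phi> k))\<^sup>2 = 2"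
      using that by (subst norm_add_square) (simp add: n1 cinner_minus_right basis_inner)
    then have "1\<^sup>2 < (dist (\<phi> j) (\<phi> k))\<^sup>2"
      by (simp add: dist_norm)
    then show ?thesis
      by (rule power2_less_imp_less) simp
  qed
  define s where "s = enumerate ?I"
  have s: "s n \<in> ?I" for n
    unfolding s_def by (rule enumerate_in_set[OF inf])
  have "\<forall>n. \<phi> (s n) \<in> closure (R ` Q)"
    using s sub by blast
  then obtain l r where r: "strict_mono r" "((\<lambda>n. \<phi> (s n)) \<circ> r) \<longlonglongrightarrow> l"
    using K unfolding compact_eq_seq_compact_metric seq_compact_def by metis
  have "Cauchy ((\<lambda>n. \<phi> (s n)) \<circ> r)"
    using r(2) by (rule LIMSEQ_imp_Cauchy)
  then obtain M where M: "dist (\<phi> (s (r m))) (\<phi> (s (r n))) < 1" if "m \<ge> M" "n \<ge> M" for m n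
    unfolding Cauchy_def o_def by (meson zero_less_one)
  have "s (r M) < s (r (Suc M))"
    using r(1) strict_mono_enumerate[OF inf] by (simp add: s_def strict_mono_def)
  then have "1 < dist (\<phi> (s (r M))) (\<phi> (s (r (Suc M))))"
    using s[of "r M"] s[of "r (Suc M)"] by (intro sep) auto
  then show False
    using M[of M "Suc M"] by simp
qed

definition low_modes :: "real \<Rightarrow> int set" where
  "low_modes t = {k. k \<noteq> 0 \<and> lam (nat \<bar>k\<bar>) \<le> t}"

lemma finite_low_modes:
  assumes "compact_resolvent A0" shows "finite (low_modes t)"
proof (rule finite_subset)
  let ?I = "{k. k \<ge> 1 \<and> lam k \<le> t}"
  show "low_modes t \<subseteq> int ` ?I \<union> (\<lambda>k. - int k) ` ?I"
  proof
    fix k assume k: "k \<in> low_modes t"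
    then have "nat \<bar>k\<bar> \<in> ?I" by (auto simp: low_modes_def)
    moreover have "k = int (nat \<bar>k\<bar>) \<or> k = - int (nat \<bar>k\<bar>)" by linarith
    ultimately show "k \<in> int ` ?I \<union> (\<lambda>k. - int k) ` ?I" by blast
  qed
qed (use finite_low_eigenvalues[OF assms] in simp)

lemma mode_coeff_le_N:
  assumes "z \<in> X" "k \<noteq> 0" shows "(cmod (mode_coeff z k))\<^sup>2 \<le> (N z)\<^sup>2"
  using finite_sum_le_has_sum[OF mode_coeff_has_sum[OF assms(1)], of "{k}"] assms(2) by simp

lemma freq_absA_pos:
  assumes z: "z \<in> dom_A - {0}" shows "0 < freq_absA S lam \<phi> z"
proof -
  have zX: "z \<in> X" using z by (simp add: dom_A_subset_X)
  have "lam 1 * (N z)\<^sup>2 \<le> quadratic_form z"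
  proof (rule has_sum_mono)
    show "((\<lambda>k. lam 1 * (cmod (mode_coeff z k))\<^sup>2) has_sum lam 1 * (N z)\<^sup>2) (UNIV - {0})"
      by (intro has_sum_cmult_right mode_coeff_has_sum zX)
    show "((\<lambda>k. lam (nat \<bar>k\<bar>) * (cmod (mode_coeff z k))\<^sup>2) has_sum quadratic_form z) (UNIV - {0})"
      using z by (intro weighted_mode_coeff_has_sum) simp
    show "lam 1 * (cmod (mode_coeff z k))\<^sup>2 \<le> lam (nat \<bar>k\<bar>) * (cmod (mode_coeff z k))\<^sup>2"
      if "k \<in> UNIV - {0}" for k
      using that by (intro mult_right_mono lam_mono) auto
  qed
  moreover have "0 < lam 1 * (N z)\<^sup>2"
    using N_pos[OF zX] z lam_pos[of 1] by simp
  ultimately show ?thesis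
    using z N_pos[OF zX] by (simp add: freq_absA_eq)
qed

text \<open>By Markov's inequality at least half of the mass of \<open>z\<close> sits in the modes of frequency at most
  twice the mean frequency \<open>\<Lambda>\<close>. There are finitely many of these, so one of them carries its
  share.\<close>

lemma exists_heavy_low_mode:
  assumes "compact_resolvent A0" and z: "z \<in> dom_A - {0}"
  defines "\<Lambda> \<equiv> freq_absA S lam \<phi> z"
  obtains k where "k \<in> low_modes (2 * \<Lambda>)"
    and "(N z)\<^sup>2 \<le> 2 * real (card (low_modes (2 * \<Lambda>))) * (cmod (mode_coeff z k))\<^sup>2"
proof -
  let ?F = "low_modes (2 * \<Lambda>)" and ?q = "\<lambda>k. (cmod (mode_coeff z k))\<^sup>2"
  have zX: "z \<in> X" and zD: "z \<in> dom_A" using z by (simp_all add: dom_A_subset_X)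
  have Np: "0 < N z" using N_pos[OF zX] z by simp
  have \<Lambda>: "0 < \<Lambda>" and q: "quadratic_form z = \<Lambda> * (N z)\<^sup>2"
    using freq_absA_pos[OF z] Np by (simp_all add: \<Lambda>_def freq_absA_eq[OF zD])
  have fin: "finite ?F" by (rule finite_low_modes[OF assms(1)])
  have sub: "?F \<subseteq> UNIV - {0}" by (auto simp: low_modes_def)
  have tail: "(?q has_sum (N z)\<^sup>2 - sum ?q ?F) (UNIV - {0} - ?F)"
    using sub fin by (intro has_sum_Diff mode_coeff_has_sum zX has_sum_finite)
  \<comment> \<open>Outside the low modes each weight exceeds \<open>2 \<Lambda>\<close>, while the weighted sum is only
    \<open>\<Lambda> (N z)\<^sup>2\<close>.\<close>
  have "((\<lambda>k. lam (nat \<bar>k\<bar>) * ?q k) has_sum quadratic_form z - (\<Sum>k\<in>?F. lam (nat \<bar>k\<bar>) * ?q k))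
      (UNIV - {0} - ?F)"
    using sub fin by (intro has_sum_Diff weighted_mode_coeff_has_sum zD has_sum_finite)
  then have "2 * \<Lambda> * ((N z)\<^sup>2 - sum ?q ?F) \<le> quadratic_form z - (\<Sum>k\<in>?F. lam (nat \<bar>k\<bar>) * ?q k)"
    by (rule has_sum_mono[OF has_sum_cmult_right[OF tail]])
      (auto simp: low_modes_def intro!: mult_right_mono)
  moreover have "0 \<le> (\<Sum>k\<in>?F. lam (nat \<bar>k\<bar>) * ?q k)"
    using lam_pos by (intro sum_nonneg mult_nonneg_nonneg[OF less_imp_le]) (auto simp: low_modes_def Suc_le_eq)
  ultimately have "\<Lambda> * (N z)\<^sup>2 \<le> \<Lambda> * (2 * sum ?q ?F)"
    using q by (simp add: algebra_simps)
  then have half: "(N z)\<^sup>2 \<le> 2 * sum ?q ?F"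
    using \<Lambda> by simp
  have "\<exists>k\<in>?F. (N z)\<^sup>2 \<le> 2 * real (card ?F) * ?q k"
  proof (rule ccontr)
    assume "\<not> ?thesis"
    then have "\<And>k. k \<in> ?F \<Longrightarrow> 2 * real (card ?F) * ?q k < (N z)\<^sup>2"
      by (simp add: not_le)
    moreover have card: "0 < card ?F"
      using half Np fin by (auto simp: card_gt_0_iff)
    ultimately have "(\<Sum>k\<in>?F. 2 * real (card ?F) * ?q k) < real (card ?F) * (N z)\<^sup>2"
      by (rule sum_bounded_above_strict)
    then have "real (card ?F) * (2 * sum ?q ?F) < real (card ?F) * (N z)\<^sup>2"
      by (simp add: sum_distrib_left mult_ac)
    then show False
      using half card by simp
  qed
  then show thesis using that by blast
qed

end

section \<open>Time averages along the group\<close>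

locale wave_group = wave_operator A0 S lam \<phi>
  for A0 S :: "('h::complex_hilbert, 'h) unbdd_op" and lam :: "nat \<Rightarrow> real" and \<phi> :: "nat \<Rightarrow> 'h" +
  fixes U :: "real \<Rightarrow> 'h \<times> 'h \<Rightarrow> 'h \<times> 'h"
  assumes exp_itA: "is_exp_itA A0 S U"
begin

lemma U_clinear: "clinear_on X (U t)"
  and U_in_X [simp]: "z \<in> X \<Longrightarrow> U t z \<in> X" and N_U [simp]: "z \<in> X \<Longrightarrow> N (U t z) = N z"
  and U_0 [simp]: "z \<in> X \<Longrightarrow> U 0 z = z" and U_add: "z \<in> X \<Longrightarrow> U (s + t) z = U s (U t z)"
  and U_continuous: "z \<in> X \<Longrightarrow> ((\<lambda>t. N (U t z - z)) \<longlongrightarrow> 0) (at 0)"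
  and U_generator: "z \<in> X \<Longrightarrow> w \<in> X \<Longrightarrow>
    ((\<lambda>t. N ((1 / t) *\<^sub>R (U t z - z) - w)) \<longlongrightarrow> 0) (at 0) \<longleftrightarrow> z \<in> dom_A \<and> w = \<i> *\<^sub>C A z"
  using exp_itA by (auto simp: is_exp_itA_def isometry_group_generated_by_def iA_op_def)

lemmas U_simps = clinear_on_simps[OF U_clinear]

text \<open>Since \<open>U t\<close> is a linear isometry that commutes with the group, difference quotients along an
  orbit are images of those at time \<open>0\<close>. So the behaviour at time \<open>0\<close> decides invariance of the domain,
  differentiability and continuity at all times.\<close>

lemma U_difference_quotient:
  assumes "z \<in> X" "w \<in> X"
  shows "(1 / h) *\<^sub>R (U (t + h) z - U t z) - U t w = U t ((1 / h) *\<^sub>R (U h z - z) - w)"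
proof -
  have "U h z - z \<in> X" using assms by (simp add: X_closed)
  then show ?thesis
    using assms by (simp add: U_add U_simps X_closed)
qed

lemma
  assumes z: "z \<in> dom_A"
  shows U_dom_A: "U t z \<in> dom_A" and A_U: "A (U t z) = U t (A z)"
proof -
  have zX: "z \<in> X" and Az: "A z \<in> X" "\<i> *\<^sub>C A z \<in> X"
    using z by (simp_all add: dom_A_subset_X A_in_X X_closed)
  have "((\<lambda>h. N ((1 / h) *\<^sub>R (U h z - z) - \<i> *\<^sub>C A z)) \<longlongrightarrow> 0) (at 0)"
    using U_generator[OF zX Az(2)] z by simp
  moreover have "N ((1 / h) *\<^sub>R (U h (U t z) - U t z) - U t (\<i> *\<^sub>C A z))
      = N ((1 / h) *\<^sub>R (U h z - z) - \<i> *\<^sub>C A z)" for h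
  proof -
    have "(1 / h) *\<^sub>R (U h z - z) - \<i> *\<^sub>C A z \<in> X"
      using zX Az by (intro X_closed) auto
    moreover have "U h (U t z) = U (t + h) z"
      by (simp add: U_add[symmetric] zX add.commute)
    ultimately show ?thesis
      using U_difference_quotient[OF zX Az(2), of h t] by simp
  qed
  ultimately have "((\<lambda>h. N ((1 / h) *\<^sub>R (U h (U t z) - U t z) - U t (\<i> *\<^sub>C A z))) \<longlongrightarrow> 0) (at 0)"
    by simp
  then have "U t z \<in> dom_A \<and> U t (\<i> *\<^sub>C A z) = \<i> *\<^sub>C A (U t z)"
    using U_generator[of "U t z" "U t (\<i> *\<^sub>C A z)"] zX Az by simp
  then show "U t z \<in> dom_A" "A (U t z) = U t (A z)"
    using Az(1) by (simp_all add: U_simps)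
qed

text \<open>The generator is defined by limits in the energy norm; they are also limits in \<open>H \<times> H\<close>,
  a Banach space in which curves can be integrated, because the energy norm dominates its norm.\<close>

lemma U_has_vector_derivative:
  assumes z: "z \<in> dom_A"
  shows "((\<lambda>t. U t z) has_vector_derivative \<i> *\<^sub>C A (U t z)) (at t within T)"
proof -
  define w where "w = \<i> *\<^sub>C A z"
  have zX: "z \<in> X" and wX: "w \<in> X"
    using z by (simp_all add: dom_A_subset_X A_in_X X_closed w_def)
  have w: "U t w = \<i> *\<^sub>C A (U t z)"
    using A_in_X[OF z] by (simp add: w_def U_simps A_U[OF z])
  let ?c = "1 / lam 1 + 1"
  have "((\<lambda>h. N ((1 / h) *\<^sub>R (U h z - z) - w)) \<longlongrightarrow> 0) (at 0)"
    using U_generator[OF zX wX] z by (simp add: w_def)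
  then have lim: "((\<lambda>h. ?c * N ((1 / h) *\<^sub>R (U h z - z) - w)) \<longlongrightarrow> 0) (at 0)"
    by (rule tendsto_mult_right_zero)
  have bound: "norm ((1 / h) *\<^sub>R (U (t + h) z - U t z) - U t w) \<le> ?c * N ((1 / h) *\<^sub>R (U h z - z) - w)" for h
  proof -
    have X: "(1 / h) *\<^sub>R (U h z - z) - w \<in> X"
      using zX wX by (intro X_closed) auto
    show ?thesis
      unfolding U_difference_quotient[OF zX wX] using norm_le_N[OF U_in_X[OF X]] by (simp add: X)
  qed
  have "((\<lambda>h. (1 / h) *\<^sub>R (U (t + h) z - U t z) - U t w) \<longlongrightarrow> 0) (at 0)"
    by (rule Lim_null_comparison[OF _ lim]) (use bound in simp)
  then have "((\<lambda>h. norm ((1 / h) *\<^sub>R (U (t + h) z - U t z) - U t w)) \<longlongrightarrow> 0) (at 0)"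
    by (rule tendsto_norm_zero)
  moreover have "\<forall>\<^sub>F h in at 0. norm ((1 / h) *\<^sub>R (U (t + h) z - U t z) - U t w)
      = norm (U (t + h) z - U t z - h *\<^sub>R U t w) / norm h"
  proof (rule eventually_mono[OF eventually_neq_at_within[of 0 0 UNIV]])
    fix h :: real assume h: "h \<noteq> 0"
    then have "(1 / h) *\<^sub>R (U (t + h) z - U t z) - U t w = (1 / h) *\<^sub>R (U (t + h) z - U t z - h *\<^sub>R U t w)"
      by (simp add: scaleR_diff_right)
    then show "norm ((1 / h) *\<^sub>R (U (t + h) z - U t z) - U t w)
      = norm (U (t + h) z - U t z - h *\<^sub>R U t w) / norm h"
      by (metis norm_scaleR abs_divide abs_one real_norm_def times_divide_eq_left mult_1)
  qed
  ultimately have "((\<lambda>h. norm (U (t + h) z - U t z - h *\<^sub>R U t w) / norm h) \<longlongrightarrow> 0) (at 0)"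
    by (rule Lim_transform_eventually)
  then have "((\<lambda>t. U t z) has_vector_derivative U t w) (at t)"
    unfolding has_vector_derivative_def has_derivative_at by (simp add: bounded_linear_scaleR_left)
  then show ?thesis
    unfolding w by (rule has_vector_derivative_at_within)
qed

lemma N_U_diff: "z \<in> X \<Longrightarrow> N (U t z - U s z) = N (U (t - s) z - z)"
proof -
  assume z: "z \<in> X"
  have "U t z - U s z = U s (U (t - s) z - z)"
    using U_add[OF z, of s "t - s"] z by (simp add: U_simps)
  then show ?thesis using z by (simp add: X_closed)
qed

lemma continuous_U_components:
  assumes z: "z \<in> X"
  shows "continuous_on T (\<lambda>t. op_app S (fst (U t z)))"
    and "continuous_on T (\<lambda>t. fst (U t z))" and "continuous_on T (\<lambda>t. snd (U t z))"
proof -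
  have cont: "continuous_on T f"
    if f: "\<And>t s. norm (f t - f s) \<le> c * N (U t z - U s z)" for f :: "real \<Rightarrow> 'h" and c
    unfolding continuous_on_def
  proof
    fix s
    have "((\<lambda>h. c * N (U h z - z)) \<longlongrightarrow> 0) (at 0)"
      by (rule tendsto_mult_right_zero[OF U_continuous[OF z]])
    then have "((\<lambda>h. f (s + h) - f s) \<longlongrightarrow> 0) (at 0)"
      by (rule Lim_null_comparison[rotated]) (use f[of "s + h" s for h] N_U_diff[OF z, of "s + h" s for h] in simp)
    then have "isCont f s"
      by (simp add: isCont_iff LIM_zero_iff)
    then show "(f \<longlongrightarrow> f s) (at s within T)"
      by (simp add: continuous_at_imp_continuous_at_within continuous_within[symmetric])
  qed
  have X: "U t z \<in> X" "U t z - U s z \<in> X" for t s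
    using z by (simp_all add: X_closed)
  show "continuous_on T (\<lambda>t. op_app S (fst (U t z)))"
    using norm_S_fst_le[of "U t z - U s z" for t s] X(1)
    by (intro cont[of _ 1]) (simp add: X_iff)
  show "continuous_on T (\<lambda>t. fst (U t z))"
    by (rule cont[of _ "1 / lam 1"]) (use norm_fst_le[OF X(2)] in simp)
  show "continuous_on T (\<lambda>t. snd (U t z))"
    by (rule cont[of _ 1]) (use norm_snd_le[of "U t z - U s z" for t s] in simp)
qed

text \<open>\<open>X_inner\<close> involves the unbounded operator, but against an eigenvector of \<open>A\<close> it is a functional
  that is continuous for the norm of \<open>H \<times> H\<close>.\<close>

definition eigen_functional :: "real \<Rightarrow> nat \<Rightarrow> 'h \<times> 'h \<Rightarrow> complex" where
  "eigen_functional \<mu> j z = \<i> * \<mu> * cinner (fst z) (\<phi> j) + cinner (snd z) (\<phi> j)"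

lemma mode_coeff_eq_functional:
  assumes "z \<in> X" "k \<noteq> 0"
  shows "mode_coeff z k = eigen_functional (eigval_A lam k) (nat \<bar>k\<bar>) z / sqrt 2"
proof -
  have "sgn (of_int k) = complex_of_real (sgn (real_of_int k))"
    by (metis of_real_of_int_eq sgn_of_real)
  moreover have "nat \<bar>k\<bar> \<ge> 1" using assms(2) by simp
  ultimately show ?thesis
    using assms S_coeff[of "fst z" "nat \<bar>k\<bar>"]
    by (simp add: mode_coeff_eq eigen_functional_def eigval_A_def X_iff)
qed

lemma eigen_functional_A:
  assumes z: "z \<in> dom_A" and j: "j \<ge> 1" and \<mu>: "\<mu>\<^sup>2 = (lam j)\<^sup>2"
  shows "eigen_functional \<mu> j (A z) = \<mu> * eigen_functional \<mu> j z"
proof -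
  have d: "fst z \<in> op_dom A0" using z by (simp add: dom_A_iff)
  then have "cinner (op_app A0 (fst z)) (\<phi> j) = lam j * (lam j * cinner (fst z) (\<phi> j))"
    using j by (simp add: A0_eq dom_A0_iff S_coeff)
  also have "\<dots> = complex_of_real ((lam j)\<^sup>2) * cinner (fst z) (\<phi> j)"
    by (simp add: power2_eq_square)
  also have "\<dots> = \<mu> * \<mu> * cinner (fst z) (\<phi> j)"
    unfolding \<mu>[symmetric] by (simp add: power2_eq_square)
  finally show ?thesis
    by (simp add: eigen_functional_def A_eq cinner_minus_left cinner_scaleC_left algebra_simps)
qed

text \<open>The orbit of the group generated by \<open>i (A - \<mu>)\<close>: it leaves the eigenspace of \<open>A\<close> at \<open>\<mu>\<close> fixed
  and oscillates on its complement, so integrating it in time singles out that eigenspace.\<close>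

definition twisted :: "real \<Rightarrow> 'h \<times> 'h \<Rightarrow> real \<Rightarrow> 'h \<times> 'h" where
  "twisted \<mu> z t = exp (t *\<^sub>R (- (\<i> * \<mu>))) *\<^sub>C U t z"

definition twisted_integral :: "real \<Rightarrow> 'h \<times> 'h \<Rightarrow> real \<Rightarrow> 'h \<times> 'h" where
  "twisted_integral \<mu> z T =
    (integral {0..T} (\<lambda>t. fst (twisted \<mu> z t)), integral {0..T} (\<lambda>t. snd (twisted \<mu> z t)))"

lemma cmod_phase: "cmod (exp (t *\<^sub>R (- (\<i> * complex_of_real \<mu>)))) = 1"
  by simp

lemma twisted_0: "z \<in> X \<Longrightarrow> twisted \<mu> z 0 = z"
  by (simp add: twisted_def)

lemma twisted_in_dom_A: "z \<in> dom_A \<Longrightarrow> twisted \<mu> z t \<in> dom_A"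
  using U_dom_A[of z t] by (simp add: twisted_def dom_A_iff scaleC_prod_def)

lemma A_twisted: "z \<in> dom_A \<Longrightarrow> A (twisted \<mu> z t) = twisted \<mu> (A z) t"
  using U_dom_A[of z t] unfolding twisted_def A_U[symmetric]
  by (simp add: A_eq dom_A_iff scaleC_prod_def scaleC_scaleC mult.commute)

lemma N_twisted: "z \<in> X \<Longrightarrow> N (twisted \<mu> z t) = N z"
  unfolding twisted_def by (simp only: N_scaleC[OF U_in_X] cmod_phase N_U)

lemma continuous_twisted:
  assumes z: "z \<in> X"
  shows "continuous_on T (\<lambda>t. op_app S (fst (twisted \<mu> z t)))"
    and "continuous_on T (\<lambda>t. fst (twisted \<mu> z t))" and "continuous_on T (\<lambda>t. snd (twisted \<mu> z t))"
proof -
  have c: "continuous_on T (\<lambda>t. exp (t *\<^sub>R (- (\<i> * complex_of_real \<mu>))))"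
    by (intro continuous_intros)
  have "op_app S (fst (twisted \<mu> z t)) = exp (t *\<^sub>R (- (\<i> * \<mu>))) *\<^sub>C op_app S (fst (U t z))" for t
    using U_in_X[OF z, of t] by (simp add: twisted_def scaleC_prod_def X_iff)
  then show "continuous_on T (\<lambda>t. op_app S (fst (twisted \<mu> z t)))"
    using bounded_bilinear.continuous_on[OF bounded_bilinear_scaleC c continuous_U_components(1)[OF z]]
    by simp
  show "continuous_on T (\<lambda>t. fst (twisted \<mu> z t))" "continuous_on T (\<lambda>t. snd (twisted \<mu> z t))"
    using bounded_bilinear.continuous_on[OF bounded_bilinear_scaleC c continuous_U_components(2)[OF z]]
      bounded_bilinear.continuous_on[OF bounded_bilinear_scaleC c continuous_U_components(3)[OF z]]
    by (simp_all add: twisted_def scaleC_prod_def)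
qed

lemma twisted_has_vector_derivative:
  assumes z: "z \<in> dom_A" and h: "h = fst \<or> h = snd"
  shows "((\<lambda>t. h (twisted \<mu> z t)) has_vector_derivative
    \<i> *\<^sub>C h (A (twisted \<mu> z t) - \<mu> *\<^sub>R twisted \<mu> z t)) (at t within T)"
proof -
  have bl: "bounded_linear h"
    using h bounded_linear_fst bounded_linear_snd by auto
  have hs: "h (c *\<^sub>C w) = c *\<^sub>C h w" for c w
    using h by (auto simp: scaleC_prod_def)
  let ?e = "\<lambda>t. exp (t *\<^sub>R (- (\<i> * complex_of_real \<mu>)))"
  have "((\<lambda>t. ?e t *\<^sub>C h (U t z)) has_vector_derivative
      ?e t *\<^sub>C h (\<i> *\<^sub>C A (U t z)) + (?e t * (- (\<i> * \<mu>))) *\<^sub>C h (U t z)) (at t within T)"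
    by (intro bounded_bilinear.has_vector_derivative[OF bounded_bilinear_scaleC]
        exp_scaleR_has_vector_derivative_right bounded_linear.has_vector_derivative[OF bl]
        U_has_vector_derivative z)
  moreover have "?e t *\<^sub>C h (\<i> *\<^sub>C A (U t z)) + (?e t * (- (\<i> * \<mu>))) *\<^sub>C h (U t z)
      = \<i> *\<^sub>C h (A (twisted \<mu> z t) - \<mu> *\<^sub>R twisted \<mu> z t)"
  proof -
    have "h (A (twisted \<mu> z t) - \<mu> *\<^sub>R twisted \<mu> z t) = ?e t *\<^sub>C h (A (U t z)) - (\<mu> * ?e t) *\<^sub>C h (U t z)"
      unfolding A_twisted[OF z] A_U[OF z]
      unfolding twisted_def by (simp only: linear_diff[OF bounded_linear.linear[OF bl]]
          scaleR_scaleC[where 'a = "'h \<times> 'h"] hs scaleC_scaleC)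
    then show ?thesis
      by (simp add: hs complex_vs.scale_right_diff_distrib scaleC_scaleC mult_ac)
  qed
  ultimately show ?thesis
    by (simp add: twisted_def hs)
qed

text \<open>With \<open>p\<close> the orbit of \<open>z\<close>, the orbit of \<open>A z\<close> is \<open>(- i p\<^sub>2, i A\<^sub>0 p\<^sub>1)\<close>. Its continuity
  in the energy norm is the continuity of \<open>p\<close> in the graph norms that is needed to move \<open>A\<^sub>0\<close> and
  \<open>A\<^sub>0\<^sup>1\<^sup>/\<^sup>2\<close> inside the integral.\<close>

lemma twisted_integral_in_dom_A:
  assumes z: "z \<in> dom_A"
  shows "twisted_integral \<mu> z T \<in> dom_A"
    and "op_app A0 (fst (twisted_integral \<mu> z T)) = integral {0..T} (\<lambda>t. op_app A0 (fst (twisted \<mu> z t)))"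
    and "continuous_on {0..T} (\<lambda>t. op_app A0 (fst (twisted \<mu> z t)))"
proof -
  have zX: "z \<in> X" and AX: "A z \<in> X" using z by (simp_all add: dom_A_subset_X A_in_X)
  have d: "fst (twisted \<mu> z t) \<in> op_dom A0" "snd (twisted \<mu> z t) \<in> op_dom S" for t
    using twisted_in_dom_A[OF z, of \<mu> t] by (simp_all add: dom_A_iff)
  have A: "twisted \<mu> (A z) t = (- (\<i> *\<^sub>C snd (twisted \<mu> z t)), \<i> *\<^sub>C op_app A0 (fst (twisted \<mu> z t)))" for t
    using A_twisted[OF z, of \<mu> t] by (simp add: A_eq)
  have A0: "op_app A0 (fst (twisted \<mu> z t)) = (- \<i>) *\<^sub>C snd (twisted \<mu> (A z) t)" for t
    by (simp add: A scaleC_scaleC)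
  have S: "op_app S (snd (twisted \<mu> z t)) = \<i> *\<^sub>C op_app S (fst (twisted \<mu> (A z) t))" for t
    using d(2)[of t] by (simp add: A scaleC_scaleC)
  note sc = bounded_linear.continuous_on[OF bounded_bilinear.bounded_linear_right[OF bounded_bilinear_scaleC]]
  show cA: "continuous_on {0..T} (\<lambda>t. op_app A0 (fst (twisted \<mu> z t)))"
    unfolding A0 by (rule sc[OF continuous_twisted(3)[OF AX]])
  have cS: "continuous_on {0..T} (\<lambda>t. op_app S (snd (twisted \<mu> z t)))"
    unfolding S by (rule sc[OF continuous_twisted(1)[OF AX]])
  note I1 = self_adjoint_integral[OF A0_self_adjoint continuous_twisted(2)[OF zX] cA d(1)]
  note I2 = self_adjoint_integral[OF S_self_adjoint continuous_twisted(3)[OF zX] cS d(2)]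
  show "twisted_integral \<mu> z T \<in> dom_A"
    using I1(1) I2(1) by (simp add: dom_A_iff twisted_integral_def)
  show "op_app A0 (fst (twisted_integral \<mu> z T)) = integral {0..T} (\<lambda>t. op_app A0 (fst (twisted \<mu> z t)))"
    using I1(2) by (simp add: twisted_integral_def)
qed

text \<open>The integrand is \<open>- i\<close> times a derivative, so the integral is a boundary term.\<close>

lemma twisted_integral_almost_eigenvector:
  fixes \<mu> T :: real
  assumes z: "z \<in> dom_A" and T: "0 \<le> T"
  defines "W \<equiv> twisted_integral \<mu> z T"
  shows "A W - \<mu> *\<^sub>R W = (- \<i>) *\<^sub>C (twisted \<mu> z T - z)"
proof -
  have zX: "z \<in> X" using z by (simp add: dom_A_subset_X)
  let ?p = "twisted \<mu> z"
  note lin = has_integral_linear[OF _ bounded_bilinear.bounded_linear_right[OF bounded_bilinear_scaleC], unfolded o_def]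
  have ftc: "((\<lambda>t. h (A (?p t) - \<mu> *\<^sub>R ?p t)) has_integral (- \<i>) *\<^sub>C h (?p T - z)) {0..T}"
    if h: "h = fst \<or> h = snd" for h
  proof -
    have "((\<lambda>t. \<i> *\<^sub>C h (A (?p t) - \<mu> *\<^sub>R ?p t)) has_integral h (?p T) - h (?p 0)) {0..T}"
      by (intro fundamental_theorem_of_calculus T twisted_has_vector_derivative z h)
    from lin[OF this, of "- \<i>"] show ?thesis
      using h by (auto simp: scaleC_scaleC twisted_0[OF zX])
  qed
  have i1: "((\<lambda>t. fst (?p t)) has_integral fst W) {0..T}"
    and i2: "((\<lambda>t. snd (?p t)) has_integral snd W) {0..T}"
    and i3: "((\<lambda>t. op_app A0 (fst (?p t))) has_integral op_app A0 (fst W)) {0..T}"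
    unfolding W_def twisted_integral_in_dom_A(2)[OF z]
    using continuous_twisted(2,3)[OF zX] twisted_integral_in_dom_A(3)[OF z]
    by (auto simp: twisted_integral_def intro!: integrable_integral integrable_continuous_interval)
  have "((\<lambda>t. fst (A (?p t) - \<mu> *\<^sub>R ?p t)) has_integral fst (A W - \<mu> *\<^sub>R W)) {0..T}"
    using has_integral_diff[OF has_integral_neg[OF lin[OF i2, of \<i>]] has_integral_cmul[OF i1, of \<mu>]]
    by (simp add: A_eq)
  moreover have "((\<lambda>t. snd (A (?p t) - \<mu> *\<^sub>R ?p t)) has_integral snd (A W - \<mu> *\<^sub>R W)) {0..T}"
    using has_integral_diff[OF lin[OF i3, of \<i>] has_integral_cmul[OF i2, of \<mu>]]
    by (simp add: A_eq)
  ultimately have "fst (A W - \<mu> *\<^sub>R W) = (- \<i>) *\<^sub>C fst (?p T - z)"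
    "snd (A W - \<mu> *\<^sub>R W) = (- \<i>) *\<^sub>C snd (?p T - z)"
    using ftc has_integral_unique by blast+
  then show ?thesis
    by (simp add: prod_eq_iff scaleC_prod_def)
qed

text \<open>The coefficient of the twisted orbit along the eigenvector is constant, its derivative being the
  coefficient of \<open>i (A - \<mu>)\<close> applied to the orbit.\<close>

lemma mode_coeff_twisted_integral:
  assumes z: "z \<in> dom_A" and T: "0 \<le> T" and k: "k \<noteq> 0"
  shows "mode_coeff (twisted_integral (eigval_A lam k) z T) k = T * mode_coeff z k"
proof -
  define \<mu> j where "\<mu> = eigval_A lam k" and "j = nat \<bar>k\<bar>"
  have zX: "z \<in> X" using z by (simp add: dom_A_subset_X)
  have j: "j \<ge> 1" using k by (simp add: j_def)
  have "\<mu>\<^sup>2 = (lam j)\<^sup>2"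
    using k by (auto simp: \<mu>_def j_def eigval_A_def sgn_if)
  note LA = eigen_functional_A[OF _ j this]
  let ?L = "eigen_functional \<mu> j" and ?p = "twisted \<mu> z"
  note comp = bounded_linear_cinner_left[of "\<phi> j"]
  have const: "?L (?p s) = ?L z" if "0 \<le> s" for s
  proof -
    have "((\<lambda>t. ?L (?p t)) has_vector_derivative 0) (at t within {0..s})" for t
    proof -
      let ?r = "A (?p t) - \<mu> *\<^sub>R ?p t"
      have "((\<lambda>t. ?L (?p t)) has_vector_derivative
          \<i> * \<mu> * cinner (\<i> *\<^sub>C fst ?r) (\<phi> j) + cinner (\<i> *\<^sub>C snd ?r) (\<phi> j)) (at t within {0..s})"
        unfolding eigen_functional_def
        by (intro has_vector_derivative_add has_vector_derivative_mult_right
            bounded_linear.has_vector_derivative[OF comp] twisted_has_vector_derivative z) auto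
      moreover have "\<i> * \<mu> * cinner (\<i> *\<^sub>C fst ?r) (\<phi> j) + cinner (\<i> *\<^sub>C snd ?r) (\<phi> j)
          = \<i> * (?L (A (?p t)) - \<mu> * ?L (?p t))"
        by (simp add: eigen_functional_def cinner_scaleC_left cinner_diff_left cinner_scaleR_left
            scaleR_conv_of_real algebra_simps)
      ultimately show ?thesis
        by (simp add: LA twisted_in_dom_A z)
    qed
    then have "((\<lambda>t. 0) has_integral ?L (?p s) - ?L (?p 0)) {0..s}"
      using that by (intro fundamental_theorem_of_calculus)
    then show ?thesis
      using has_integral_unique[OF _ has_integral_0] by (force simp: twisted_0[OF zX])
  qed
  have "((\<lambda>t. ?L (?p t)) has_integral ?L (twisted_integral \<mu> z T)) {0..T}"
    unfolding eigen_functional_def twisted_integral_def fst_conv snd_conv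
    by (intro has_integral_add has_integral_mult_right has_integral_linear[OF _ comp, unfolded o_def]
        integrable_integral integrable_continuous_interval continuous_twisted zX)
  moreover have "((\<lambda>t. ?L (?p t)) has_integral T *\<^sub>R ?L z) {0..T}"
    using has_integral_const_real[of "?L z" 0 T] T
    by (intro has_integral_eq[OF const[symmetric]]) auto
  ultimately have "?L (twisted_integral \<mu> z T) = T *\<^sub>R ?L z"
    by (rule has_integral_unique)
  moreover have "twisted_integral \<mu> z T \<in> X"
    by (intro dom_A_subset_X twisted_integral_in_dom_A z)
  ultimately show ?thesis
    using zX k by (simp add: mode_coeff_eq_functional \<mu>_def[symmetric] j_def[symmetric] scaleR_conv_of_real)
qed

text \<open>The observation commutes with the integral, and the phase does not change its norm.\<close>

lemma observation_twisted_integral: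
  fixes C0 :: "'h \<Rightarrow> 'y::complex_hilbert"
  assumes C0: "bounded_from_dom A0 C0" and z: "z \<in> dom_A" and T: "0 < T"
  shows "(norm (C0 (fst (twisted_integral \<mu> z T))))\<^sup>2
    \<le> T * integral {0..T} (\<lambda>t. (norm (C_op C0 (U t z)))\<^sup>2)"
proof -
  have zX: "z \<in> X" using z by (simp add: dom_A_subset_X)
  have d: "fst (twisted \<mu> z t) \<in> op_dom A0" for t
    using twisted_in_dom_A[OF z] by (simp add: dom_A_iff)
  note C = bounded_from_dom_integral[OF A0_self_adjoint C0 less_imp_le[OF T]
      continuous_twisted(2)[OF zX] twisted_integral_in_dom_A(3)[OF z] d]
  have "C0 (fst (twisted \<mu> z t)) = exp (t *\<^sub>R (- (\<i> * \<mu>))) *\<^sub>C C_op C0 (U t z)" for t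
  proof -
    have "clinear_on (op_dom A0) C0" "fst (U t z) \<in> op_dom A0"
      using C0 U_dom_A[OF z] by (simp_all add: bounded_from_dom_def dom_A_iff)
    then show ?thesis
      by (simp add: twisted_def scaleC_prod_def C_op_def clinear_on_simps)
  qed
  then have "norm (C0 (fst (twisted \<mu> z t))) = norm (C_op C0 (U t z))" for t
    by (simp only: norm_scaleC cmod_phase mult_1)
  then show ?thesis
    using norm_integral_power2_le[OF C(1) T] C(2)
    by (simp add: twisted_integral_def)
qed

section \<open>Weak observability\<close>

text \<open>The integral \<open>W\<close> over \<open>[0, \<tau>]\<close> of the orbit twisted by the eigenvalue \<open>\<mu>\<close> of a heavy low mode
  satisfies \<open>\<parallel>W\<parallel> \<ge> \<tau> |\<langle>z, \<psi>\<^sub>k\<rangle>|\<close> and \<open>\<parallel>(A - \<mu>) W\<parallel> \<le> 2 \<parallel>z\<parallel>\<close>. For large \<open>\<tau>\<close> the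
  resolvent estimate at \<open>\<mu>\<close> therefore forces the observation of \<open>W\<close> to be large, and with it the
  observation along the orbit. The estimate gives
  \<open>\<tau>\<^sup>2 \<parallel>z\<parallel>\<^sup>2 \<le> 2 n (a \<tau> J + 4 b \<parallel>z\<parallel>\<^sup>2)\<close>, where \<open>n\<close> bounds the number of low modes and \<open>J\<close> is the
  observed energy. The choice \<open>\<tau>\<^sup>2 \<ge> 16 n b\<close> absorbs the last term, and \<open>\<tau> \<ge> 1\<close> turns the
  remaining lower bound for \<open>J\<close> into one that is non-increasing in the frequency. All constants are evaluated at
  \<open>2 \<Lambda> \<ge> |\<mu>|\<close>, and \<open>n\<close> is a continuous majorant of the counting function.\<close>
lemma weakly_observable_of_resolvent_estimate:
  fixes C0 :: "'h \<Rightarrow> 'y::complex_hilbert"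
  assumes a: "a \<in> Sigma_i" and b: "b \<in> Sigma_i"
    and est: "\<And>\<mu> z. z \<in> dom_A \<Longrightarrow>
      (N z)\<^sup>2 \<le> a \<mu> * (norm (C0 (fst z)))\<^sup>2 + b \<mu> * (N (A z - \<mu> *\<^sub>R z))\<^sup>2"
    and C0: "bounded_from_dom A0 C0" and cpt: "compact_resolvent A0"
  shows "weakly_observable A0 S lam \<phi> C0 U"
proof -
  have "mono_on {0..} (\<lambda>t. real (card (low_modes t)))"
    by (auto simp: monotone_on_def low_modes_def intro!: card_mono finite_low_modes[OF cpt, unfolded low_modes_def])
  then obtain n where n: "n \<in> Sigma_i" and n1: "\<And>x. 1 \<le> n x"
    and card: "\<And>x. 0 \<le> x \<Longrightarrow> real (card (low_modes x)) \<le> n x"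
    using continuous_majorant_in_Sigma_i[of "\<lambda>t. real (card (low_modes t))"] by auto
  define T where "T x = 1 + sqrt (16 * n (2 * x) * b (2 * x))" for x
  define \<Psi> where "\<Psi> x = 1 / (4 * n (2 * x) * a (2 * x))" for x
  have "T \<in> Sigma_i" "\<Psi> \<in> Sigma_d"
    unfolding T_def \<Psi>_def
    by (intro Sigma_i_add Sigma_i_const Sigma_i_sqrt Sigma_i_mult Sigma_i_dilation Sigma_d_divide a b n; simp)+
  moreover have "\<Psi> (freq_absA S lam \<phi> z) * (N z)\<^sup>2 \<le>
      integral {0..T (freq_absA S lam \<phi> z)} (\<lambda>t. (norm (C_op C0 (U t z)))\<^sup>2)"
    if z: "z \<in> dom_A - {0}" for z
  proof -
    define \<Lambda> where "\<Lambda> = freq_absA S lam \<phi> z"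
    have zD: "z \<in> dom_A" and zX: "z \<in> X" using z by (simp_all add: dom_A_subset_X)
    have \<Lambda>: "0 < \<Lambda>" using freq_absA_pos[OF z] by (simp add: \<Lambda>_def)
    obtain k where k: "k \<in> low_modes (2 * \<Lambda>)"
      and heavy: "(N z)\<^sup>2 \<le> 2 * real (card (low_modes (2 * \<Lambda>))) * (cmod (mode_coeff z k))\<^sup>2"
      using exists_heavy_low_mode[OF cpt z] unfolding \<Lambda>_def by blast
    have k0: "k \<noteq> 0" and lam_k: "lam (nat \<bar>k\<bar>) \<le> 2 * \<Lambda>" using k by (auto simp: low_modes_def)
    define \<mu> where "\<mu> = eigval_A lam k"
    have "0 < lam (nat \<bar>k\<bar>)" using k0 by (intro lam_pos) linarith
    then have \<mu>: "\<bar>\<mu>\<bar> \<le> \<bar>2 * \<Lambda>\<bar>"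
      using lam_k by (auto simp: \<mu>_def eigval_A_def sgn_if)
    define n' a' b' \<tau> where "n' = n (2 * \<Lambda>)" and "a' = a (2 * \<Lambda>)" and "b' = b (2 * \<Lambda>)" and "\<tau> = T \<Lambda>"
    define J where "J = integral {0..\<tau>} (\<lambda>t. (norm (C_op C0 (U t z)))\<^sup>2)"
    have pos: "0 < n'" "0 < a'" "0 < b'" "a \<mu> \<le> a'" "b \<mu> \<le> b'"
      using n a b \<mu> by (simp_all add: n'_def a'_def b'_def Sigma_i_pos Sigma_i_le)
    have \<tau>: "1 \<le> \<tau>" "16 * n' * b' \<le> \<tau>\<^sup>2"
    proof -
      have s: "0 \<le> sqrt (16 * n' * b')" "(sqrt (16 * n' * b'))\<^sup>2 = 16 * n' * b'" using pos by simp_all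
      then show "1 \<le> \<tau>" by (simp add: \<tau>_def T_def n'_def b'_def)
      have "(sqrt (16 * n' * b'))\<^sup>2 \<le> \<tau>\<^sup>2"
        using s(1) by (intro power_mono) (simp_all add: \<tau>_def T_def n'_def b'_def)
      then show "16 * n' * b' \<le> \<tau>\<^sup>2" using s(2) by simp
    qed
    define W where "W = twisted_integral \<mu> z \<tau>"
    have WD: "W \<in> dom_A" and WX: "W \<in> X"
      unfolding W_def by (auto intro: twisted_integral_in_dom_A zD dom_A_subset_X)
    have obs: "(norm (C0 (fst W)))\<^sup>2 \<le> \<tau> * J"
      unfolding W_def J_def using \<tau> by (intro observation_twisted_integral C0 zD) simp
    have "A W - \<mu> *\<^sub>R W = (- \<i>) *\<^sub>C (twisted \<mu> z \<tau> - z)"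
      unfolding W_def using \<tau> by (intro twisted_integral_almost_eigenvector zD) simp
    moreover have "twisted \<mu> z \<tau> - z \<in> X"
      using zX twisted_in_dom_A[OF zD] by (simp add: X_closed dom_A_subset_X)
    ultimately have "N (A W - \<mu> *\<^sub>R W) = cmod (- \<i>) * N (twisted \<mu> z \<tau> - z)"
      by (simp only: N_scaleC)
    also have "\<dots> \<le> 2 * N z"
      using N_triangle[OF dom_A_subset_X[OF twisted_in_dom_A[OF zD]] zX, of \<mu> \<tau>] by (simp add: N_twisted[OF zX])
    finally have small: "(N (A W - \<mu> *\<^sub>R W))\<^sup>2 \<le> 4 * (N z)\<^sup>2"
      using power_mono[OF _ N_nonneg, of _ "2 * N z" 2] by (simp add: power_mult_distrib)
    have "(N z)\<^sup>2 \<le> 2 * n' * (cmod (mode_coeff z k))\<^sup>2"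
    proof -
      have "2 * real (card (low_modes (2 * \<Lambda>))) * (cmod (mode_coeff z k))\<^sup>2 \<le> 2 * n' * (cmod (mode_coeff z k))\<^sup>2"
        using card[of "2 * \<Lambda>"] \<Lambda> by (intro mult_right_mono) (simp_all add: n'_def)
      then show ?thesis using heavy by linarith
    qed
    then have "\<tau>\<^sup>2 * (N z)\<^sup>2 \<le> \<tau>\<^sup>2 * (2 * n' * (cmod (mode_coeff z k))\<^sup>2)"
      by (intro mult_left_mono) auto
    also have "\<dots> = 2 * n' * (cmod (mode_coeff W k))\<^sup>2"
      using mode_coeff_twisted_integral[OF zD _ k0, of \<tau>] \<tau>
      by (simp add: W_def \<mu>_def norm_mult power_mult_distrib)
    also have "\<dots> \<le> 2 * n' * (N W)\<^sup>2"
      using pos mode_coeff_le_N[OF WX k0] by (intro mult_left_mono) auto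
    also have "(N W)\<^sup>2 \<le> a \<mu> * (norm (C0 (fst W)))\<^sup>2 + b \<mu> * (N (A W - \<mu> *\<^sub>R W))\<^sup>2"
      by (rule est[OF WD])
    also have "\<dots> \<le> a' * (\<tau> * J) + b' * (4 * (N z)\<^sup>2)"
      using pos obs small by (intro add_mono mult_mono) auto
    finally have "\<tau>\<^sup>2 * (N z)\<^sup>2 \<le> 2 * n' * (a' * (\<tau> * J) + b' * (4 * (N z)\<^sup>2))"
      using pos by simp
    moreover have "16 * n' * b' * (N z)\<^sup>2 \<le> \<tau>\<^sup>2 * (N z)\<^sup>2"
      using \<tau>(2) by (intro mult_right_mono) auto
    ultimately have "\<tau>\<^sup>2 * (N z)\<^sup>2 \<le> 4 * n' * a' * \<tau> * J"
      by (simp add: algebra_simps)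
    then have "\<tau> * (\<tau> * (N z)\<^sup>2) \<le> \<tau> * (4 * n' * a' * J)"
      by (simp add: power2_eq_square mult_ac)
    then have "\<tau> * (N z)\<^sup>2 \<le> 4 * n' * a' * J"
      using \<tau>(1) by simp
    moreover have "(N z)\<^sup>2 \<le> \<tau> * (N z)\<^sup>2"
      using mult_right_mono[OF \<tau>(1), of "(N z)\<^sup>2"] by simp
    ultimately have "(N z)\<^sup>2 \<le> 4 * n' * a' * J"
      by linarith
    then show ?thesis
      using pos unfolding J_def \<tau>_def \<Psi>_def \<Lambda>_def[symmetric] n'_def[symmetric] a'_def[symmetric]
      by (simp add: field_simps)
  qed
  ultimately show ?thesis
    unfolding weakly_observable_def by blast
qed

end

theorem theorem3p2:
  fixes A0 S :: "('h::complex_hilbert, 'h) unbdd_op"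
    and lam :: "nat \<Rightarrow> real" and \<phi> :: "nat \<Rightarrow> 'h"
    and C0 :: "'h \<Rightarrow> 'y::complex_hilbert"
    and U :: "real \<Rightarrow> 'h \<times> 'h \<Rightarrow> 'h \<times> 'h"
    and \<Psi>0 \<epsilon>0 :: "real \<Rightarrow> real"
  assumes "self_adjoint A0" and "positive_op A0" and "unbounded_op A0" and "compact_resolvent A0"
    and "is_sqrt_op S A0"
    and "eigenbasis S lam \<phi>"
    and "bounded_from_dom A0 C0"
    and "is_exp_itA A0 S U"
    and "admissible A0 S C0 U"
    and "\<Psi>0 \<in> Sigma_d" and "\<epsilon>0 \<in> Sigma_d"
    and "\<And>\<omega> u. u \<in> op_dom A0 - {0} \<Longrightarrow>
           \<omega>\<^sup>2 * (norm u)\<^sup>2 + (norm (op_app S u))\<^sup>2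
             \<le> max ((norm (C0 u))\<^sup>2 / \<Psi>0 \<omega>) ((norm (op_app A0 u - \<omega>\<^sup>2 *\<^sub>R u))\<^sup>2 / \<epsilon>0 \<omega>)"
  shows "weakly_observable A0 S lam \<phi> C0 U \<and>
    (\<exists>\<Psi>\<in>Sigma_d. \<exists>\<epsilon>\<in>Sigma_d. \<forall>\<mu>::real. \<forall>z\<in>op_dom (A_op A0 S) - {0}.
       (X_norm S z)\<^sup>2
         \<le> max ((norm (C_op C0 z))\<^sup>2 / \<Psi> (freq_absA S lam \<phi> z))
               ((X_norm S (op_app (A_op A0 S) z - \<mu> *\<^sub>R z))\<^sup>2
                  / ((\<mu> - freq_A A0 S z)\<^sup>2 + \<epsilon> (freq_absA S lam \<phi> z))))"
proof -
  interpret wave_group A0 S lam \<phi> U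
    by unfold_locales (fact assms)+
  define a where "a \<mu> = 2 / \<Psi>0 \<mu>" for \<mu>
  define b where "b \<mu> = 4 * (1 + \<mu>\<^sup>2 / (lam 1)\<^sup>2) / \<epsilon>0 \<mu> + 2 / (lam 1)\<^sup>2" for \<mu>
  have b_eq: "b = (\<lambda>\<mu>. (1 + \<mu>\<^sup>2 / (lam 1)\<^sup>2) * (4 / \<epsilon>0 \<mu>) + 2 / (lam 1)\<^sup>2)"
    by (simp add: b_def fun_eq_iff)
  have a: "a \<in> Sigma_i"
    unfolding a_def by (intro Sigma_i_divide assms) simp
  have b: "b \<in> Sigma_i"
    unfolding b_eq using lam_pos[of 1]
    by (intro Sigma_i_add Sigma_i_mult Sigma_i_divide Sigma_i_one_plus_square Sigma_i_const assms) auto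
  have est: "(N z)\<^sup>2 \<le> a \<mu> * (norm (C0 (fst z)))\<^sup>2 + b \<mu> * (N (A z - \<mu> *\<^sub>R z))\<^sup>2"
    if "z \<in> dom_A" for \<mu> z
    unfolding a_def b_def
    by (rule first_order_resolvent_estimate[OF _ _ assms(12) that])
      (use assms(10,11) in \<open>simp_all add: Sigma_d_def\<close>)
  have "weakly_observable A0 S lam \<phi> C0 U"
    by (rule weakly_observable_of_resolvent_estimate[OF a b est assms(7,4)])
  moreover have "(\<lambda>x. 1 / (2 * a x)) \<in> Sigma_d" "(\<lambda>x. 1 / (2 * b x)) \<in> Sigma_d"
    by (intro Sigma_d_divide Sigma_i_mult Sigma_i_const a b; simp)+
  moreover have "(N z)\<^sup>2 \<le> max ((norm (C_op C0 z))\<^sup>2 / (1 / (2 * a (freq_absA S lam \<phi> z))))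
      ((N (A z - \<mu> *\<^sub>R z))\<^sup>2 / ((\<mu> - freq_A A0 S z)\<^sup>2 + 1 / (2 * b (freq_absA S lam \<phi> z))))"
    if "z \<in> dom_A - {0}" for \<mu> z
    by (rule frequency_resolvent_inequality[OF a b est that])
  ultimately show ?thesis
    by (intro conjI bexI[of _ "\<lambda>x. 1 / (2 * a x)"] bexI[of _ "\<lambda>x. 1 / (2 * b x)"] allI ballI)
qed

end
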